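(* Let $G$ be a finite non-cyclic group. Then the following three statements are equivalent: (1) $G$ is nilpotent; (2) there is a subgroup $S$ of $G$ such that $G$ has an $ES$-partition, $S \unlhd G$, and $S \leq Z_i(G)$ for some $i \in \mathbb{N}$; (3) for every non-cyclic subgroup $H$ of $G$ there is a subgroup $S \leq H$ such that $H$ has an $ES$-partition.
   Context: Let $X$ be a finite group and $S$ a proper subgroup of $X$. A strict $S$-partition of $X$ is a finite set $\{H_1,\dots,H_n\}$ of (distinct) proper subgroups of $X$ such that $X = \bigcup_{i=1}^n H_i$ and $H_i \cap H_j = S$ for all $i \neq j$. It is called an equal strict $S$-partition, or $ES$-partition, if in addition $|H_i| = |H_j|$ for all $i, j$. $Z_i(G)$ denotes the $i$-th term of the upper central series of $G$. *)

theory Defs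
  imports "HOL-Algebra.Algebra"
begin

definition group_center :: "('a, 'b) monoid_scheme \<Rightarrow> 'a set" where
  "group_center G = {z \<in> carrier G. \<forall>x \<in> carrier G. z \<otimes>\<^bsub>G\<^esub> x = x \<otimes>\<^bsub>G\<^esub> z}"

text \<open>The upper central series: the zeroth term is trivial, and the successor of \<open>Z\<close> is the
  preimage of the centre of \<open>G Mod Z\<close> under the canonical projection.\<close>

primrec upper_central :: "('a, 'b) monoid_scheme \<Rightarrow> nat \<Rightarrow> 'a set" where
  "upper_central G 0 = {\<one>\<^bsub>G\<^esub>}"
| "upper_central G (Suc i) =
     {x \<in> carrier G. upper_central G i #>\<^bsub>G\<^esub> x \<in> group_center (G Mod upper_central G i)}"

definition nilpotent_group :: "('a, 'b) monoid_scheme \<Rightarrow> bool" where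
  "nilpotent_group G \<longleftrightarrow> group G \<and> (\<exists>c. upper_central G c = carrier G)"

definition proper_subgroup :: "'a set \<Rightarrow> ('a, 'b) monoid_scheme \<Rightarrow> bool" where
  "proper_subgroup H G \<longleftrightarrow> subgroup H G \<and> H \<noteq> carrier G"

text \<open>The members of a partition form a set \<open>P\<close>, hence are automatically distinct; since they
  are proper subgroups covering the group, there are at least two of them.\<close>

definition strict_partition :: "('a, 'b) monoid_scheme \<Rightarrow> 'a set \<Rightarrow> 'a set set \<Rightarrow> bool" where
  "strict_partition G S P \<longleftrightarrow>
     proper_subgroup S G \<and>
     finite P \<and>
     (\<forall>H \<in> P. proper_subgroup H G) \<and>
     carrier G = \<Union>P \<and>
     (\<forall>H \<in> P. \<forall>K \<in> P. H \<noteq> K \<longrightarrow> H \<inter> K = S)"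

definition ES_partition :: "('a, 'b) monoid_scheme \<Rightarrow> 'a set \<Rightarrow> 'a set set \<Rightarrow> bool" where
  "ES_partition G S P \<longleftrightarrow>
     strict_partition G S P \<and> (\<forall>H \<in> P. \<forall>K \<in> P. card H = card K)"

end

(* A nilpotent non-cyclic group G has two maximal subgroups of the same prime index p: otherwise
   an element lying outside as many maximal subgroups as possible lies outside all of them and
   generates G. Both are normal, G has exponent p modulo their intersection N, and the subgroups
   generated by N and one element outside N form an ES-partition over N.

   If S is normal, an ES-partition of G over S gives one of G/S over the trivial group, and an
   equally partitioned group is a p-group (Isaacs): with components of order h and index m one has
   h <= m, and orbit counting under the components shows that each union F of conjugacy classes of
   the relevant kinds meets every component in the same number f < h of elements. Divisibility of
   card F by m excludes elements of composite order; divisibility by the p'-part of the order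
   bounds that part by h, so two distinct primes would give card G < h^2 <= h m = card G. Since S
   lies in the hypercentre and has prime power index, G is nilpotent.

   If every non-cyclic subgroup has an ES-partition, consider a minimal non-nilpotent subgroup G.
   As in Schmidt's theorem, G is a normal Sylow t-subgroup extended by a cyclic Sylow q-subgroup
   generated by some x. The components of an ES-partition all have order divisible by the order
   of x and are nilpotent, hence lie in centralizers of conjugates of x. So the conjugates of the
   centralizer of x cover G, which makes x central, a contradiction. *)

theory Submission
  imports Defs
begin

subsection \<open>Commutators and the upper central series\<close>

context group begin

text \<open>Nilpotency is tested by \<open>prime_commuting\<close>: elements whose orders are powers
  of different primes commute. Its failure in a minimal non-nilpotent group supplies the
  non-commuting pair on which the Sylow structure there is built. The two converse directions differ
  because of the normality of S. In (2) it allows passing to G/S, where counting applies. In (3) S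
  need not be normal in H, so there may be no quotient to count in; hence the minimal
  counterexample, where equal orders spread the full q-part of the group order from one component to
  all. In the counting, let n be the number of components. Counting non-identity elements gives |G|
  - 1 = n (h - 1), so n is prime to |G|, and h - 1 divides m - 1, whence h <= m. A set F meeting
  every component in f elements, without the identity, has n f elements, so a divisor of |G| that
  divides |F| already divides f < h.\<close>

lemma inv_cancel_left [simp]:
  assumes "x \<in> carrier G" "y \<in> carrier G"
  shows "x \<otimes> (inv x \<otimes> y) = y" "inv x \<otimes> (x \<otimes> y) = y"
  using assms by (simp_all flip: m_assoc)

lemma inv_commutes:
  assumes "x \<in> carrier G" "y \<in> carrier G" "x \<otimes> y = y \<otimes> x"
  shows "inv x \<otimes> y = y \<otimes> inv x"
proof -
  have "inv x \<otimes> y = inv x \<otimes> (y \<otimes> x) \<otimes> inv x" using assms(1,2) by (simp add: m_assoc)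
  also have "\<dots> = inv x \<otimes> (x \<otimes> y) \<otimes> inv x" using assms by simp
  also have "\<dots> = y \<otimes> inv x" using assms(1,2) by (simp add: m_assoc)
  finally show ?thesis .
qed

lemma conjugate_eq_iff:
  assumes "a \<in> carrier G" "x \<in> carrier G" "y \<in> carrier G"
  shows "a \<otimes> x \<otimes> inv a = y \<longleftrightarrow> a \<otimes> x = y \<otimes> a"
proof
  assume "a \<otimes> x \<otimes> inv a = y"
  then have "a \<otimes> x \<otimes> inv a \<otimes> a = y \<otimes> a" by simp
  then show "a \<otimes> x = y \<otimes> a" using assms by (simp add: m_assoc)
qed (use assms in \<open>simp add: m_assoc\<close>)

text \<open>With this convention \<open>commutator x y \<otimes> y\<close> is the conjugate of
  \<open>y\<close> by \<open>x\<close>, so membership of a commutator translates directly into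
  invariance under conjugation.\<close>

definition commutator :: "'a \<Rightarrow> 'a \<Rightarrow> 'a" where
  "commutator x y = x \<otimes> y \<otimes> inv x \<otimes> inv y"

lemma commutator_closed [simp, intro]:
  "\<lbrakk>x \<in> carrier G; y \<in> carrier G\<rbrakk> \<Longrightarrow> commutator x y \<in> carrier G"
  by (simp add: commutator_def)

lemma commutator_eq_one_iff:
  assumes "x \<in> carrier G" "y \<in> carrier G"
  shows "commutator x y = \<one> \<longleftrightarrow> x \<otimes> y = y \<otimes> x"
proof -
  have "commutator x y = (x \<otimes> y) \<otimes> inv (y \<otimes> x)"
    using assms by (simp add: commutator_def inv_mult_group m_assoc)
  then show ?thesis
    using assms by (metis inv_equality m_closed inv_inv inv_closed r_inv)
qed

lemma rcos_eq_iff: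
  assumes "subgroup N G" "a \<in> carrier G" "b \<in> carrier G"
  shows "N #> a = N #> b \<longleftrightarrow> a \<otimes> inv b \<in> N"
  using assms by (metis rcos_self repr_independence subgroup.rcos_module is_group)

lemma rcos_eq_commutator:
  assumes "subgroup N G" "x \<in> carrier G" "y \<in> carrier G"
  shows "N #> (x \<otimes> y) = N #> (y \<otimes> x) \<longleftrightarrow> commutator x y \<in> N"
  using assms by (subst rcos_eq_iff) (simp_all add: commutator_def inv_mult_group m_assoc)

lemma group_center_normal: "group_center G \<lhd> G"
proof (rule normal_invI)
  show "subgroup (group_center G) G"
  proof
    fix x y assume xy: "x \<in> group_center G" "y \<in> group_center G"
    then have c: "x \<in> carrier G" "y \<in> carrier G" by (auto simp: group_center_def)
    have "x \<otimes> y \<otimes> z = z \<otimes> (x \<otimes> y)" if z: "z \<in> carrier G" for z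
    proof -
      have "x \<otimes> z = z \<otimes> x" "y \<otimes> z = z \<otimes> y" using xy z by (auto simp: group_center_def)
      then show ?thesis using c z by (metis m_assoc)
    qed
    then show "x \<otimes> y \<in> group_center G" using c by (simp add: group_center_def)
  next
    fix x assume x: "x \<in> group_center G"
    show "inv x \<in> group_center G"
      using x inv_commutes[of x] unfolding group_center_def by simp
  qed (auto simp: group_center_def)
  fix x h assume "x \<in> carrier G" "h \<in> group_center G"
  then have "x \<in> carrier G" "h \<in> carrier G" "x \<otimes> h = h \<otimes> x" by (auto simp: group_center_def)
  then have "x \<otimes> h \<otimes> inv x = h" by (simp add: m_assoc)
  then show "x \<otimes> h \<otimes> inv x \<in> group_center G" using \<open>h \<in> group_center G\<close> by simp
qed

text \<open>The successor term is the union of the cosets forming the centre of the quotient, hence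
  the preimage of a normal subgroup.\<close>

lemma upper_central_normal: "upper_central G i \<lhd> G"
proof (induction i)
  case 0
  then show ?case by (simp add: one_is_normal)
next
  case (Suc i)
  then interpret N: normal "upper_central G i" G .
  have c: "group_center (G Mod upper_central G i) \<lhd> (G Mod upper_central G i)"
    by (rule group.group_center_normal) (rule N.factorgroup_is_group)
  then have "upper_central G (Suc i) = \<Union> (group_center (G Mod upper_central G i))"
    by (simp add: N.factgroup_subgroup_union_char normal_imp_subgroup)
  then show ?case using N.factgroup_subgroup_union_normal[OF c] by simp
qed

lemma upper_central_subgroup: "subgroup (upper_central G i) G"
  by (simp add: normal_imp_subgroup upper_central_normal)

lemma upper_central_subset: "upper_central G i \<subseteq> carrier G"
  by (simp add: subgroup.subset upper_central_subgroup)

text \<open>A coset is central in the quotient exactly when all commutators of a representative fall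
  into the previous term. This elementwise form is the default from here on, so the quotient
  equation leaves the simp set.\<close>

lemma upper_central_Suc_iff:
  "x \<in> upper_central G (Suc i) \<longleftrightarrow>
     x \<in> carrier G \<and> (\<forall>y \<in> carrier G. commutator x y \<in> upper_central G i)"
proof -
  interpret N: normal "upper_central G i" G by (rule upper_central_normal)
  show ?thesis
    by (auto simp: upper_central.simps group_center_def carrier_FactGroup N.rcos_sum
        simp flip: rcos_eq_commutator[OF upper_central_subgroup])
qed

declare upper_central.simps(2) [simp del]

lemma commutator_mem_normal:
  assumes "N \<lhd> G" "x \<in> N" "y \<in> carrier G"
  shows "commutator x y \<in> N"
proof -
  interpret normal N G by fact
  have "commutator x y = x \<otimes> (y \<otimes> inv x \<otimes> inv y)"
    using assms by (simp add: commutator_def m_assoc)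
  then show ?thesis using assms by (simp add: inv_op_closed2)
qed

lemma upper_central_mono: "i \<le> j \<Longrightarrow> upper_central G i \<subseteq> upper_central G j"
proof (rule lift_Suc_mono_le)
  show "upper_central G n \<subseteq> upper_central G (Suc n)" for n
    using commutator_mem_normal[OF upper_central_normal] upper_central_subset[of n]
    by (auto simp: upper_central_Suc_iff)
qed

text \<open>The largest term is the hypercentre. An element that is central modulo it already
  belongs to it, which is the source of the contradictions in the nilpotency proofs.\<close>

lemma upper_central_stable:
  assumes "finite (carrier G)"
  obtains c where "upper_central G (Suc c) = upper_central G c" "\<And>i. upper_central G i \<subseteq> upper_central G c"
proof -
  have "finite (range (upper_central G))"
  proof (rule finite_subset)
    show "range (upper_central G) \<subseteq> Pow (carrier G)" using upper_central_subset by blast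
  qed (simp add: assms)
  then obtain c where c: "\<And>i. upper_central G c \<subseteq> upper_central G i \<Longrightarrow> upper_central G c = upper_central G i"
    using finite_has_maximal[of "range (upper_central G)"] by auto
  have "upper_central G i \<subseteq> upper_central G c" for i
    using c[of "max i c"] upper_central_mono[of i "max i c"] upper_central_mono[of c "max i c"] by auto
  moreover have "upper_central G (Suc c) = upper_central G c"
    using c[of "Suc c"] upper_central_mono[of c "Suc c"] by simp
  ultimately show thesis using that by blast
qed

text \<open>Commutators of elements of \<open>H\<close> are the same in \<open>H\<close> and in
  \<open>G\<close>, so the elementwise description passes down. Equality fails in general, as
  \<open>H\<close> offers fewer elements to commute with.\<close>

lemma upper_central_Int_subgroup:
  assumes H: "subgroup H G"
  shows "upper_central G i \<inter> H \<subseteq> upper_central (G\<lparr>carrier := H\<rparr>) i"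
proof -
  interpret H: group "G\<lparr>carrier := H\<rparr>" by (rule subgroup_imp_group[OF H])
  have comm: "H.commutator x y = commutator x y" if "x \<in> H" "y \<in> H" for x y
    using that H by (simp add: H.commutator_def commutator_def)
  show ?thesis
  proof (induction i)
    case 0
    then show ?case using H subgroup.one_closed by auto
  next
    case (Suc i)
    have closed: "commutator x y \<in> H" if "x \<in> H" "y \<in> H" for x y
      using that H by (simp add: commutator_def subgroup.m_closed subgroup.m_inv_closed)
    have "H.commutator x y \<in> upper_central (G\<lparr>carrier := H\<rparr>) i"
      if "x \<in> upper_central G (Suc i)" "x \<in> H" "y \<in> H" for x y
    proof -
      have "commutator x y \<in> upper_central G i"
        using that subgroup.subset[OF H] by (auto simp: upper_central_Suc_iff)
      then show ?thesis
        using that Suc closed comm by auto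
    qed
    then show ?case by (auto simp: H.upper_central_Suc_iff)
  qed
qed

lemma nilpotent_subgroup:
  assumes "nilpotent_group G" "subgroup H G"
  shows "nilpotent_group (G\<lparr>carrier := H\<rparr>)"
proof -
  interpret H: group "G\<lparr>carrier := H\<rparr>" by (rule subgroup_imp_group) fact
  obtain c where "upper_central G c = carrier G"
    using assms unfolding nilpotent_group_def by blast
  then have "H \<subseteq> upper_central (G\<lparr>carrier := H\<rparr>) c"
    using upper_central_Int_subgroup[OF assms(2), of c] subgroup.subset[OF assms(2)] by auto
  then show ?thesis
    unfolding nilpotent_group_def using H.upper_central_subset H.is_group by fastforce
qed

text \<open>For normal \<open>N\<close> this is the preimage of the centralizer of the coset of
  \<open>y\<close> in the quotient by \<open>N\<close>.\<close>

definition centralizer_mod :: "'a set \<Rightarrow> 'a \<Rightarrow> 'a set" where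
  "centralizer_mod N y = {g \<in> carrier G. commutator y g \<in> N}"

lemma centralizer_mod_subgroup:
  assumes N: "N \<lhd> G" and y: "y \<in> carrier G"
  shows "subgroup (centralizer_mod N y) G"
proof -
  interpret N: normal N G by fact
  have eq: "centralizer_mod N y = {g \<in> carrier G. (N #> y) <#> (N #> g) = (N #> g) <#> (N #> y)}"
    using y by (auto simp: centralizer_mod_def N.rcos_sum simp flip: rcos_eq_commutator[OF N.is_subgroup])
  interpret Q: group "G Mod N" by (rule N.factorgroup_is_group)
  have Y: "N #> y \<in> carrier (G Mod N)" using y by (auto simp: carrier_FactGroup)
  show ?thesis
  proof
    fix g h assume gh: "g \<in> centralizer_mod N y" "h \<in> centralizer_mod N y"
    then have c: "g \<in> carrier G" "h \<in> carrier G" by (auto simp: centralizer_mod_def)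
    then have "N #> g \<in> carrier (G Mod N)" "N #> h \<in> carrier (G Mod N)" by (auto simp: carrier_FactGroup)
    then show "g \<otimes> h \<in> centralizer_mod N y"
      using gh c Y Q.m_assoc[of "N #> y" "N #> g" "N #> h"] Q.m_assoc[of "N #> g" "N #> h" "N #> y"]
        Q.m_assoc[of "N #> g" "N #> y" "N #> h"]
      unfolding eq by (simp flip: N.rcos_sum)
  next
    fix g assume g: "g \<in> centralizer_mod N y"
    then have c: "g \<in> carrier G" by (auto simp: centralizer_mod_def)
    then have G: "N #> g \<in> carrier (G Mod N)" by (auto simp: carrier_FactGroup)
    have "(N #> y) \<otimes>\<^bsub>G Mod N\<^esub> (N #> g) = (N #> g) \<otimes>\<^bsub>G Mod N\<^esub> (N #> y)"
      using g unfolding eq by simp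
    then have "inv\<^bsub>G Mod N\<^esub> (N #> g) \<otimes>\<^bsub>G Mod N\<^esub> (N #> y) = (N #> y) \<otimes>\<^bsub>G Mod N\<^esub> inv\<^bsub>G Mod N\<^esub> (N #> g)"
      using G Y Q.inv_commutes by simp
    then show "inv g \<in> centralizer_mod N y"
      using c G unfolding eq by (simp add: N.inv_FactGroup N.rcos_inv)
  next
    show "\<one> \<in> centralizer_mod N y"
      using y N.one_closed by (simp add: centralizer_mod_def commutator_def)
  qed (auto simp: centralizer_mod_def)
qed

abbreviation centralizer :: "'a \<Rightarrow> 'a set" where
  "centralizer x \<equiv> {g \<in> carrier G. g \<otimes> x = x \<otimes> g}"

lemma centralizer_subgroup:
  assumes "x \<in> carrier G"
  shows "subgroup (centralizer x) G"
proof -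
  have "centralizer x = centralizer_mod {\<one>} x"
    using assms by (auto simp: centralizer_mod_def commutator_eq_one_iff)
  then show ?thesis using centralizer_mod_subgroup[OF one_is_normal assms] by simp
qed

end

section \<open>Orbit counting and groups of prime power order\<close>

lemma (in group_action) dvd_card_invariant_set:
  assumes "finite E" "T \<subseteq> E" "\<And>g x. \<lbrakk>g \<in> carrier G; x \<in> T\<rbrakk> \<Longrightarrow> (\<phi> g) x \<in> T"
    and "\<And>x. x \<in> T \<Longrightarrow> d dvd card (orbit G \<phi> x)"
  shows "d dvd card T"
proof -
  have "T = \<Union> (orbit G \<phi> ` T)"
    using assms orbit_refl by (fastforce simp: orbit_def)
  moreover have "card (\<Union> (orbit G \<phi> ` T)) = sum card (orbit G \<phi> ` T)"
  proof (rule card_Union_disjoint)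
    have "orbit G \<phi> ` T \<subseteq> orbits G E \<phi>" using assms(2) by (auto simp: orbits_def)
    then show "pairwise disjnt (orbit G \<phi> ` T)"
      unfolding pairwise_def disjnt_def using disjoint_union by (meson subsetD)
    show "finite A" if "A \<in> orbit G \<phi> ` T" for A
      using that \<open>T = _\<close> assms(1,2) by (metis Union_upper finite_subset)
  qed
  moreover have "d dvd sum card (orbit G \<phi> ` T)" using assms(4) by (intro dvd_sum) auto
  ultimately show ?thesis by simp
qed

context group begin

lemma card_subgroup_dvd: "subgroup H G \<Longrightarrow> card H dvd order G"
  using lagrange by (metis dvd_triv_right)

lemma card_subgroup_dvd_subgroup:
  assumes "subgroup H G" "subgroup K G" "H \<subseteq> K"
  shows "card H dvd card K"
proof -
  interpret K: group "G\<lparr>carrier := K\<rparr>" by (rule subgroup_imp_group) fact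
  show ?thesis using K.card_subgroup_dvd[OF subgroup_incl[OF assms]] by (simp add: order_def)
qed

text \<open>The \<open>A\<close>-orbit of \<open>x\<close> has length the index of
  \<open>A \<inter> centralizer x\<close> in \<open>A\<close>. The assumption on \<open>d\<close>
  names this index as the cofactor \<open>k\<close>, so that no division occurs.\<close>

lemma dvd_card_conjugation_invariant:
  assumes fin: "finite (carrier G)" and A: "subgroup A G" and T: "T \<subseteq> carrier G"
    and inv: "\<And>a x. \<lbrakk>a \<in> A; x \<in> T\<rbrakk> \<Longrightarrow> a \<otimes> x \<otimes> inv a \<in> T"
    and d: "\<And>x k. \<lbrakk>x \<in> T; k * card (A \<inter> centralizer x) = card A\<rbrakk> \<Longrightarrow> d dvd k"
  shows "d dvd card T"
proof -
  let ?\<phi> = "\<lambda>g. \<lambda>h \<in> carrier G. g \<otimes> h \<otimes> inv g"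
  interpret act: group_action "G\<lparr>carrier := A\<rparr>" "carrier G" ?\<phi>
    by (rule group_action.induced_action[OF action_by_conjugation A])
  show ?thesis
  proof (rule act.dvd_card_invariant_set[OF fin T])
    fix x assume x: "x \<in> T"
    then have "x \<in> carrier G" using T by auto
    moreover have "stabilizer (G\<lparr>carrier := A\<rparr>) ?\<phi> x = A \<inter> centralizer x"
      using subgroup.subset[OF A] \<open>x \<in> carrier G\<close>
      by (auto simp: stabilizer_def subset_iff) (metis conjugate_eq_iff)+
    ultimately show "d dvd card (orbit (G\<lparr>carrier := A\<rparr>) ?\<phi> x)"
      using act.orbit_stabilizer_theorem[of x] d[OF x] by (simp add: order_def)
  qed (use inv T in auto)
qed

end

lemma dvd_prime_power_nat:
  fixes p :: nat
  assumes "Factorial_Ring.prime p" "a dvd p ^ k" "a \<noteq> 1"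
  shows "p dvd a"
proof -
  obtain i where "i \<le> k" "a = p ^ i" using assms divides_primepow_nat[OF assms(1)] by blast
  then show ?thesis using assms(3) by (cases i) auto
qed

context group begin

text \<open>The non-central elements split into classes of length divisible by \<open>p\<close>, so
  \<open>p\<close> also divides the order of the centre.\<close>

lemma prime_power_order_center:
  assumes "order G = p ^ k" "Factorial_Ring.prime p" "order G \<noteq> 1"
  obtains z where "z \<in> group_center G" "z \<noteq> \<one>"
proof -
  have fin: "finite (carrier G)"
    using assms by (metis order_gt_0_iff_finite prime_gt_0_nat zero_less_power)
  let ?T = "carrier G - group_center G"
  have cs: "subgroup (group_center G) G" by (simp add: group_center_normal normal_imp_subgroup)
  have "p dvd card ?T"
  proof (rule dvd_card_conjugation_invariant[OF fin subgroup_self])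
    fix a x assume a: "a \<in> carrier G" "x \<in> ?T"
    interpret C: normal "group_center G" G by (rule group_center_normal)
    show "a \<otimes> x \<otimes> inv a \<in> ?T"
    proof (rule ccontr)
      assume "a \<otimes> x \<otimes> inv a \<notin> ?T"
      then have "a \<otimes> x \<otimes> inv a \<in> group_center G" using a by auto
      then have "inv a \<otimes> (a \<otimes> x \<otimes> inv a) \<otimes> a \<in> group_center G" using a by (intro C.inv_op_closed1) auto
      moreover have "inv a \<otimes> (a \<otimes> x \<otimes> inv a) \<otimes> a = x"
        using a by (simp add: m_assoc)
      ultimately show False using a by simp
    qed
  next
    fix x m assume x: "x \<in> ?T" and m: "m * card (carrier G \<inter> centralizer x) = card (carrier G)"
    have "m dvd order G" using m unfolding order_def by (metis dvd_triv_left)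
    then have "m dvd p ^ k" using assms(1) by simp
    moreover have "m \<noteq> 1"
    proof
      assume "m = 1"
      then have "carrier G \<inter> centralizer x = carrier G"
        using m fin by (intro card_subset_eq) auto
      then have "z \<otimes> x = x \<otimes> z" if "z \<in> carrier G" for z using that by blast
      then show False using x by (simp add: group_center_def)
    qed
    ultimately show "p dvd m" using dvd_prime_power_nat assms(2) by blast
  qed auto
  moreover have "p dvd card (carrier G)"
    using dvd_prime_power_nat[of p "order G" k] assms by (simp add: order_def)
  ultimately have "p dvd card (group_center G)"
    using card_Diff_subset[of "group_center G" "carrier G"] card_mono[OF fin subgroup.subset[OF cs]]
      subgroup.subset[OF cs] finite_subset[OF subgroup.subset[OF cs] fin]
    by (metis dvd_diff_nat diff_diff_cancel)
  then have "card (group_center G) \<noteq> 1" using assms(2) by auto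
  then have "group_center G \<noteq> {\<one>}" by auto
  then show thesis using that subgroup.one_closed[OF cs] by blast
qed

text \<open>Where the upper central series becomes stationary the quotient has trivial centre. Its
  order is a power of \<open>p\<close>, so the quotient is trivial.\<close>

lemma prime_power_order_nilpotent:
  assumes "order G = p ^ k" "Factorial_Ring.prime p"
  shows "nilpotent_group G"
proof -
  have fin: "finite (carrier G)"
    using assms by (metis order_gt_0_iff_finite prime_gt_0_nat zero_less_power)
  obtain c where c: "upper_central G (Suc c) = upper_central G c"
    using upper_central_stable[OF fin] by metis
  interpret Z: normal "upper_central G c" G by (rule upper_central_normal)
  interpret Q: group "G Mod upper_central G c" by (rule Z.factorgroup_is_group)
  have "order (G Mod upper_central G c) dvd p ^ k"
    using lagrange[OF Z.is_subgroup] assms(1) by (simp add: order_def FactGroup_def) (metis dvd_triv_left)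
  then obtain j where j: "order (G Mod upper_central G c) = p ^ j"
    using divides_primepow_nat[OF assms(2)] by auto
  have "order (G Mod upper_central G c) = 1"
  proof (rule ccontr)
    assume "order (G Mod upper_central G c) \<noteq> 1"
    then obtain u where u: "u \<in> group_center (G Mod upper_central G c)" "u \<noteq> upper_central G c"
      using Q.prime_power_order_center[OF j assms(2)] by auto
    then obtain x where x: "x \<in> carrier G" "u = upper_central G c #> x"
      by (auto simp: group_center_def carrier_FactGroup)
    then have "x \<in> upper_central G (Suc c)" using u by (simp add: upper_central.simps)
    then have "x \<in> upper_central G c" using c by simp
    then show False using x u by (simp add: coset_join2 Z.is_subgroup)
  qed
  then have "card (upper_central G c) = card (carrier G)"
    using lagrange[OF Z.is_subgroup] by (simp add: order_def FactGroup_def)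
  then have "upper_central G c = carrier G"
    using fin upper_central_subset by (metis card_subset_eq)
  then show ?thesis using is_group by (auto simp: nilpotent_group_def)
qed

end

subsection \<open>Nilpotency and elements of coprime order\<close>

context group begin

lemma pow_conjugate:
  assumes "a \<in> carrier G" "x \<in> carrier G"
  shows "(a \<otimes> x \<otimes> inv a) [^] (n::nat) = a \<otimes> x [^] n \<otimes> inv a"
  using assms by (induction n) (simp_all add: m_assoc)

text \<open>Let z be the commutator. Then x y x^-1 = z y and x = z (y x y^-1); since z is central,
  raising these to the powers b and a gives z^b = 1 and z^a = 1.\<close>

lemma central_commutator_eq_one:
  assumes xy: "x \<in> carrier G" "y \<in> carrier G" and pow: "x [^] (a::nat) = \<one>" "y [^] (b::nat) = \<one>"
    and cop: "coprime a b" and z: "commutator x y \<in> group_center G"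
  shows "commutator x y = \<one>"
proof -
  define z where "z = commutator x y"
  have zc: "z \<in> carrier G" using xy by (simp add: z_def)
  have zz: "z \<otimes> g = g \<otimes> z" if "g \<in> carrier G" for g
    using z that by (simp add: z_def group_center_def)
  have 1: "x \<otimes> y \<otimes> inv x = z \<otimes> y" using xy by (simp add: z_def commutator_def m_assoc)
  have "x \<otimes> y [^] b \<otimes> inv x = (z \<otimes> y) [^] b"
    using pow_conjugate[of x y b] xy 1 by simp
  also have "\<dots> = z [^] b \<otimes> y [^] b" by (rule pow_mult_distrib) (use zz zc xy in auto)
  finally have zb: "z [^] b = \<one>" using pow zc xy by simp
  have "z \<otimes> (y \<otimes> x \<otimes> inv y) = x \<otimes> y \<otimes> inv x \<otimes> (inv y \<otimes> y) \<otimes> (x \<otimes> inv y)"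
    using xy by (simp add: z_def commutator_def m_assoc del: l_inv)
  also have "\<dots> = x" using xy by (simp add: m_assoc)
  finally have "x [^] a = (z \<otimes> (y \<otimes> x \<otimes> inv y)) [^] a" by simp
  also have "\<dots> = z [^] a \<otimes> (y \<otimes> x \<otimes> inv y) [^] a" by (rule pow_mult_distrib) (use zz zc xy in auto)
  also have "\<dots> = z [^] a \<otimes> (y \<otimes> x [^] a \<otimes> inv y)" using xy by (simp add: pow_conjugate)
  finally have za: "z [^] a = \<one>" using pow zc xy by simp
  have "ord z dvd 1" using za zb zc cop pow_eq_id by (metis coprime_common_divisor is_unit_gcd_iff one_dvd)
  then show ?thesis using zc ord_eq_1 by (simp add: z_def)
qed

text \<open>The commutator descends the upper central series: if it lies in one term, its image
  modulo the previous term is central, hence trivial by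
  \<open>central_commutator_eq_one\<close>.\<close>

lemma nilpotent_coprime_commute:
  assumes "nilpotent_group G" and xy: "x \<in> carrier G" "y \<in> carrier G"
    and pow: "x [^] (a::nat) = \<one>" "y [^] (b::nat) = \<one>" and cop: "coprime a b"
  shows "x \<otimes> y = y \<otimes> x"
proof -
  obtain c where c: "upper_central G c = carrier G"
    using assms unfolding nilpotent_group_def by blast
  have step: "commutator x y \<in> upper_central G i" if i: "commutator x y \<in> upper_central G (Suc i)" for i
  proof -
    let ?N = "upper_central G i"
    interpret N: normal ?N G by (rule upper_central_normal)
    interpret Q: group "G Mod ?N" by (rule N.factorgroup_is_group)
    interpret h: group_hom G "G Mod ?N" "\<lambda>g. ?N #> g"
      by (intro group_hom.intro is_group Q.is_group group_hom_axioms.intro N.r_coset_hom_Mod)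
    have comm: "Q.commutator (?N #> x) (?N #> y) = ?N #> commutator x y"
      using xy h.hom_mult h.hom_inv by (simp add: Q.commutator_def commutator_def)
    have "Q.commutator (?N #> x) (?N #> y) = \<one>\<^bsub>G Mod ?N\<^esub>"
    proof (rule Q.central_commutator_eq_one[OF _ _ _ _ cop])
      show "Q.commutator (?N #> x) (?N #> y) \<in> group_center (G Mod ?N)"
        using i unfolding comm by (simp add: upper_central.simps)
      show "(?N #> x) [^]\<^bsub>G Mod ?N\<^esub> a = \<one>\<^bsub>G Mod ?N\<^esub>" "(?N #> y) [^]\<^bsub>G Mod ?N\<^esub> b = \<one>\<^bsub>G Mod ?N\<^esub>"
        using pow xy by (simp_all add: N.FactGroup_pow N.subset)
    qed (use xy in \<open>auto simp: carrier_FactGroup\<close>)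
    then have "?N #> commutator x y = ?N" by (simp add: comm)
    then show ?thesis using xy by (metis commutator_closed rcos_self N.is_subgroup)
  qed
  \<comment> \<open>Truncated subtraction is harmless: beyond \<open>c\<close> the index stays 0,
    and \<open>i = c\<close> already gives the trivial term.\<close>
  have "commutator x y \<in> upper_central G (c - i)" for i
  proof (induction i)
    case 0
    then show ?case using c xy by simp
  next
    case (Suc i)
    then show ?case using step[of "c - Suc i"] by (cases "i < c") (auto simp: Suc_diff_Suc)
  qed
  from this[of c] show ?thesis using xy by (simp add: commutator_eq_one_iff)
qed

section \<open>Nilpotency criteria from Sylow subgroups\<close>

lemma sylow_subgroup_exists:
  assumes "finite (carrier G)" "Factorial_Ring.prime p"
  obtains P where "subgroup P G" "card P = p ^ multiplicity p (order G)"
proof -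
  have "order G = p ^ multiplicity p (order G) * (order G div p ^ multiplicity p (order G))"
    by (simp add: multiplicity_dvd)
  then show thesis using sylow_thm[OF assms(2) is_group _ assms(1)] that by blast
qed

text \<open>Applied by placing one Sylow subgroup for each prime inside \<open>H\<close>; this
  stands in for the fact that Sylow subgroups generate the group.\<close>

lemma subgroup_eq_carrierI:
  assumes fin: "finite (carrier G)" and H: "subgroup H G"
    and dvd: "\<And>t::nat. Factorial_Ring.prime t \<Longrightarrow> t ^ multiplicity t (order G) dvd card H"
  shows "H = carrier G"
proof -
  have pos: "card H \<noteq> 0" "order G \<noteq> 0"
    using fin H by (metis card_eq_0_iff empty_iff finite_subset subgroup.one_closed subgroup.subset)
      (use fin order_gt_0_iff_finite in auto)
  have "order G dvd card H"
  proof (rule multiplicity_le_imp_dvd)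
    fix p :: nat assume "Factorial_Ring.prime p"
    then show "multiplicity p (order G) \<le> multiplicity p (card H)"
      using dvd[of p] pos by (intro multiplicity_geI) auto
  qed (use pos in auto)
  then have "card H = order G" using card_subgroup_dvd[OF H] dvd_antisym by blast
  then show ?thesis using fin subgroup.subset[OF H] by (simp add: card_subset_eq order_def)
qed

text \<open>Take \<open>y\<close> outside \<open>Z\<close> in the first term of the upper central
  series of \<open>P\<close> that leaves \<open>Z\<close>. Its commutators with \<open>P\<close>
  fall into the previous term, which is inside \<open>Z\<close>; the first such term is not term 0
  because \<open>Z\<close> contains the identity.\<close>

lemma prime_power_subgroup_central_mod:
  assumes P: "subgroup P G" "card P = p ^ k" "Factorial_Ring.prime p" and Z: "\<not> P \<subseteq> Z" "subgroup Z G"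
  obtains y where "y \<in> P - Z" "\<And>u. u \<in> P \<Longrightarrow> commutator y u \<in> Z"
proof -
  interpret P: group "G\<lparr>carrier := P\<rparr>" by (rule subgroup_imp_group) fact
  obtain c where c: "upper_central (G\<lparr>carrier := P\<rparr>) c = P"
    using P.prime_power_order_nilpotent[of p k] P by (auto simp: order_def nilpotent_group_def)
  define i where "i = (LEAST i. \<not> upper_central (G\<lparr>carrier := P\<rparr>) i \<subseteq> Z)"
  have i: "\<not> upper_central (G\<lparr>carrier := P\<rparr>) i \<subseteq> Z"
    unfolding i_def by (rule LeastI[of _ c]) (use c Z in simp)
  then obtain j where j: "i = Suc j"
    using Z(2) subgroup.one_closed by (cases i) force+
  then have jZ: "upper_central (G\<lparr>carrier := P\<rparr>) j \<subseteq> Z"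
    using not_less_Least[of j "\<lambda>i. \<not> upper_central (G\<lparr>carrier := P\<rparr>) i \<subseteq> Z"] by (simp add: i_def)
  obtain y where y: "y \<in> upper_central (G\<lparr>carrier := P\<rparr>) (Suc j)" "y \<notin> Z"
    using i j by blast
  have "commutator y u \<in> Z" if "u \<in> P" for u
  proof -
    have "P.commutator y u \<in> Z" using y that jZ by (auto simp: P.upper_central_Suc_iff)
    moreover have "y \<in> P" using y by (simp add: P.upper_central_Suc_iff)
    ultimately show ?thesis using that P(1) by (simp add: P.commutator_def commutator_def)
  qed
  moreover have "y \<in> P" using y by (simp add: P.upper_central_Suc_iff)
  ultimately show thesis using that y by blast
qed

definition prime_commuting :: bool where
  "prime_commuting \<longleftrightarrow> (\<forall>x \<in> carrier G. \<forall>y \<in> carrier G. \<forall>p q k l.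
     Factorial_Ring.prime (p::nat) \<longrightarrow> Factorial_Ring.prime (q::nat) \<longrightarrow> p \<noteq> q \<longrightarrow>
     x [^] (p ^ k) = \<one> \<longrightarrow> y [^] (q ^ l) = \<one> \<longrightarrow> x \<otimes> y = y \<otimes> x)"

lemma subgroup_pow_card:
  assumes "subgroup H G" "x \<in> H"
  shows "x [^] card H = \<one>"
proof -
  interpret H: group "G\<lparr>carrier := H\<rparr>" by (rule subgroup_imp_group) fact
  show ?thesis using H.pow_order_eq_1[of x] assms by (simp add: order_def nat_pow_consistent[symmetric])
qed

text \<open>If a Sylow \<open>p\<close>-subgroup left the hypercentre, it would contain an element
  outside the hypercentre that is central in it modulo the hypercentre. The Sylow subgroups for
  other primes commute with that element outright, so it would be central modulo the hypercentre in
  the whole group.\<close>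

lemma prime_commuting_imp_nilpotent:
  assumes fin: "finite (carrier G)" and pc: prime_commuting
  shows "nilpotent_group G"
proof -
  obtain c where c: "upper_central G (Suc c) = upper_central G c"
    using upper_central_stable[OF fin] by metis
  let ?Z = "upper_central G c"
  have "?Z = carrier G"
  proof (rule subgroup_eq_carrierI[OF fin upper_central_subgroup])
    fix p :: nat assume p: "Factorial_Ring.prime p"
    obtain P where P: "subgroup P G" "card P = p ^ multiplicity p (order G)"
      using sylow_subgroup_exists[OF fin p] .
    have "P \<subseteq> ?Z"
    proof (rule ccontr)
      assume "\<not> P \<subseteq> ?Z"
      then obtain y where y: "y \<in> P - ?Z" "\<And>u. u \<in> P \<Longrightarrow> commutator y u \<in> ?Z"
        using prime_power_subgroup_central_mod[OF P p _ upper_central_subgroup] by blast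
      have yc: "y \<in> carrier G" using y P subgroup.subset by blast
      let ?C = "centralizer_mod ?Z y"
      have C: "subgroup ?C G" by (rule centralizer_mod_subgroup[OF upper_central_normal yc])
      have "?C = carrier G"
      proof (rule subgroup_eq_carrierI[OF fin C])
        fix t :: nat assume t: "Factorial_Ring.prime t"
        obtain T where T: "subgroup T G" "card T = t ^ multiplicity t (order G)"
          using sylow_subgroup_exists[OF fin t] .
        show "t ^ multiplicity t (order G) dvd card ?C"
        proof (cases "t = p")
          case True
          have "P \<subseteq> ?C" using y subgroup.subset[OF P(1)] by (auto simp: centralizer_mod_def)
          then show ?thesis using card_subgroup_dvd_subgroup[OF P(1) C] P True by simp
        next
          case False
          have "T \<subseteq> ?C"
          proof
            fix u assume u: "u \<in> T"
            then have uc: "u \<in> carrier G" using subgroup.subset[OF T(1)] by blast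
            have "y [^] (p ^ multiplicity p (order G)) = \<one>" "u [^] (t ^ multiplicity t (order G)) = \<one>"
              using subgroup_pow_card[OF P(1)] subgroup_pow_card[OF T(1) u] y P T by auto
            then have "y \<otimes> u = u \<otimes> y"
              using pc p t False yc uc unfolding prime_commuting_def by blast
            then show "u \<in> ?C"
              using uc yc commutator_eq_one_iff[OF yc uc] subgroup.one_closed[OF upper_central_subgroup]
              by (simp add: centralizer_mod_def)
          qed
          then show ?thesis using card_subgroup_dvd_subgroup[OF T(1) C] T by simp
        qed
      qed
      then have "y \<in> upper_central G (Suc c)"
        using yc by (auto simp: upper_central_Suc_iff centralizer_mod_def)
      then show False using c y by simp
    qed
    then show "p ^ multiplicity p (order G) dvd card ?Z"
      using card_subgroup_dvd_subgroup[OF P(1) upper_central_subgroup] P by simp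
  qed
  then show ?thesis using is_group by (auto simp: nilpotent_group_def)
qed

text \<open>As for \<open>prime_commuting_imp_nilpotent\<close>, but only one prime needs care: a
  Sylow \<open>q\<close>-subgroup together with \<open>S\<close> exhausts the group order, and
  \<open>S\<close>, lying in the hypercentre, centralizes everything modulo it.\<close>

lemma prime_power_index_nilpotent:
  assumes fin: "finite (carrier G)" and S: "subgroup S G" "S \<subseteq> upper_central G i"
    and q: "Factorial_Ring.prime q" "order G = q ^ k * card S"
  shows "nilpotent_group G"
proof -
  obtain c where c: "upper_central G (Suc c) = upper_central G c" "\<And>i. upper_central G i \<subseteq> upper_central G c"
    using upper_central_stable[OF fin] by metis
  let ?Z = "upper_central G c"
  obtain P where P: "subgroup P G" "card P = q ^ multiplicity q (order G)"
    using sylow_subgroup_exists[OF fin q(1)] .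
  have full: "H = carrier G" if H: "subgroup H G" "S \<subseteq> H" "P \<subseteq> H" for H
  proof (rule subgroup_eq_carrierI[OF fin H(1)])
    fix t :: nat assume t: "Factorial_Ring.prime t"
    show "t ^ multiplicity t (order G) dvd card H"
    proof (cases "t = q")
      case True
      then show ?thesis using P card_subgroup_dvd_subgroup[OF P(1) H(1,3)] by simp
    next
      case False
      have "coprime (t ^ multiplicity t (order G)) (q ^ k)"
        using t q False by (simp add: primes_coprime)
      then have "t ^ multiplicity t (order G) dvd card S"
        using q(2) by (metis coprime_dvd_mult_right_iff multiplicity_dvd)
      then show ?thesis using card_subgroup_dvd_subgroup[OF S(1) H(1,2)] dvd_trans by blast
    qed
  qed
  have SZ: "S \<subseteq> ?Z" using S c by blast
  have "P \<subseteq> ?Z"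
  proof (rule ccontr)
    assume "\<not> P \<subseteq> ?Z"
    then obtain y where y: "y \<in> P - ?Z" "\<And>u. u \<in> P \<Longrightarrow> commutator y u \<in> ?Z"
      using prime_power_subgroup_central_mod[OF P q(1) _ upper_central_subgroup] by blast
    have yc: "y \<in> carrier G" using y P subgroup.subset by blast
    have "centralizer_mod ?Z y = carrier G"
    proof (rule full[OF centralizer_mod_subgroup[OF upper_central_normal yc]])
      show "P \<subseteq> centralizer_mod ?Z y"
        using y subgroup.subset[OF P(1)] by (auto simp: centralizer_mod_def)
      show "S \<subseteq> centralizer_mod ?Z y"
      proof
        fix s assume "s \<in> S"
        then have s: "s \<in> ?Z" "s \<in> carrier G" using SZ upper_central_subset by blast+
        interpret Z: normal ?Z G by (rule upper_central_normal)
        have "commutator y s \<in> ?Z"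
          using s yc by (simp add: commutator_def Z.inv_op_closed2)
        then show "s \<in> centralizer_mod ?Z y" using s by (simp add: centralizer_mod_def)
      qed
    qed
    then have "y \<in> upper_central G (Suc c)"
      using yc by (auto simp: upper_central_Suc_iff centralizer_mod_def)
    then show False using c y by simp
  qed
  then have "?Z = carrier G" using full[OF upper_central_subgroup SZ] by simp
  then show ?thesis using is_group by (auto simp: nilpotent_group_def)
qed

end

subsection \<open>Normalizers and Sylow subgroups\<close>

lemma not_prime_power_Suc_multiplicity_dvd:
  fixes n p :: nat
  assumes "Factorial_Ring.prime p" "n \<noteq> 0"
  shows "\<not> p ^ Suc (multiplicity p n) dvd n"
proof
  assume "p ^ Suc (multiplicity p n) dvd n"
  then have "Suc (multiplicity p n) \<le> multiplicity p n"
    using assms not_prime_unit by (intro multiplicity_geI) auto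
  then show False by simp
qed

context group begin

text \<open>By finiteness an injective conjugation mapping \<open>H\<close> into itself is onto, so
  invariance suffices instead of equality.\<close>

lemma mem_normalizer_iff:
  assumes "finite (carrier G)" "H \<subseteq> carrier G"
  shows "g \<in> normalizer G H \<longleftrightarrow> g \<in> carrier G \<and> (\<forall>h \<in> H. g \<otimes> h \<otimes> inv g \<in> H)"
proof -
  have img: "g <# H #> inv g = (\<lambda>h. g \<otimes> h \<otimes> inv g) ` H" for g
    by (auto simp: l_coset_def r_coset_def)
  have "(\<lambda>h. g \<otimes> h \<otimes> inv g) ` H = H \<longleftrightarrow> (\<forall>h \<in> H. g \<otimes> h \<otimes> inv g \<in> H)" if g: "g \<in> carrier G"
  proof
    assume "\<forall>h \<in> H. g \<otimes> h \<otimes> inv g \<in> H"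
    then show "(\<lambda>h. g \<otimes> h \<otimes> inv g) ` H = H"
    proof (intro endo_inj_surj)
      show "finite H" using assms finite_subset by blast
      show "inj_on (\<lambda>h. g \<otimes> h \<otimes> inv g) H"
        using conjugation_is_inj[OF g] assms g by (auto simp: inj_on_def subset_iff)
    qed auto
  qed auto
  then show ?thesis
    using assms by (auto simp: normalizer_def stabilizer_def img)
qed

lemma subset_normalizer:
  assumes "finite (carrier G)" "subgroup H G"
  shows "H \<subseteq> normalizer G H"
  using assms by (auto simp: mem_normalizer_iff subgroup.subset subgroup.mem_carrier
      subgroup.m_closed subgroup.m_inv_closed)

lemma normal_if_normalizer_carrier:
  assumes "finite (carrier G)" "subgroup H G" "normalizer G H = carrier G"
  shows "H \<lhd> G"
  using assms mem_normalizer_iff[of H] by (intro normal_invI) (auto simp: subgroup.subset)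

text \<open>Normalizers grow: choose \<open>x\<close> outside \<open>H\<close> in the first term of
  the upper central series not contained in \<open>H\<close>. Its commutators with \<open>H\<close>
  lie in the previous term, which is inside \<open>H\<close>.\<close>

lemma nilpotent_normalizer_condition:
  assumes nil: "nilpotent_group G" and H: "subgroup H G" "H \<noteq> carrier G"
  obtains x where "x \<in> carrier G - H" "\<And>h. h \<in> H \<Longrightarrow> x \<otimes> h \<otimes> inv x \<in> H"
proof -
  obtain c where c: "upper_central G c = carrier G"
    using nil by (auto simp: nilpotent_group_def)
  define i where "i = (LEAST i. \<not> upper_central G i \<subseteq> H)"
  have i: "\<not> upper_central G i \<subseteq> H"
    unfolding i_def by (rule LeastI[of _ c]) (use c H subgroup.subset in blast)
  then obtain j where j: "i = Suc j"
    using H(1) subgroup.one_closed by (cases i) force+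
  then have jH: "upper_central G j \<subseteq> H"
    using not_less_Least[of j "\<lambda>i. \<not> upper_central G i \<subseteq> H"] by (simp add: i_def)
  obtain x where x: "x \<in> upper_central G (Suc j)" "x \<notin> H"
    using i j by blast
  then have xc: "x \<in> carrier G" by (simp add: upper_central_Suc_iff)
  have "x \<otimes> h \<otimes> inv x \<in> H" if h: "h \<in> H" for h
  proof -
    have hc: "h \<in> carrier G" using subgroup.mem_carrier[OF H(1) h] .
    have "commutator x h \<otimes> h \<in> H"
      using x hc jH h H(1) by (intro subgroup.m_closed) (auto simp: upper_central_Suc_iff)
    then show ?thesis using xc hc by (simp add: commutator_def m_assoc)
  qed
  then show thesis using that x xc by blast
qed

lemma subgroup_coprime_powers_mem:
  assumes H: "subgroup H G" and x: "x \<in> carrier G" "x [^] (a::nat) \<in> H" "x [^] (b::nat) \<in> H"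
    and cop: "coprime a b"
  shows "x \<in> H"
proof -
  obtain u v where uv: "u * int a + v * int b = 1"
    using bezout_int[of "int a" "int b"] cop by (auto simp: coprime_iff_gcd_eq_1)
  have "(x [^] a) [^] u \<otimes> (x [^] b) [^] v = x [^] (u * int a + v * int b)"
    using x by (simp add: int_pow_mult int_pow_pow mult.commute flip: int_pow_int)
  then have "x = (x [^] a) [^] u \<otimes> (x [^] b) [^] v" using x uv by simp
  then show ?thesis using H x subgroup_int_pow_closed subgroup.m_closed by metis
qed

lemma normal_pow_index:
  assumes "N \<lhd> G" "x \<in> carrier G"
  shows "x [^] card (rcosets N) \<in> N"
proof -
  interpret normal N G by fact
  interpret Q: group "G Mod N" by (rule factorgroup_is_group)
  have "(N #> x) [^]\<^bsub>G Mod N\<^esub> order (G Mod N) = N"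
    using Q.pow_order_eq_1[of "N #> x"] assms(2) by (auto simp: carrier_FactGroup)
  then have "N #> (x [^] card (rcosets N)) = N"
    using assms(2) by (simp add: FactGroup_pow order_def) (simp add: FactGroup_def)
  then show ?thesis using assms(2) by (metis is_subgroup nat_pow_closed rcos_self)
qed

text \<open>The index of \<open>N\<close> is prime to \<open>p\<close>, and raising \<open>x\<close>
  to the index or to \<open>p ^ k\<close> lands in \<open>N\<close>; coprime exponents then put
  \<open>x\<close> itself there.\<close>

lemma normal_sylow_mem:
  assumes fin: "finite (carrier G)" and N: "N \<lhd> G" "card N = p ^ multiplicity p (order G)"
    and p: "Factorial_Ring.prime p" and x: "x \<in> carrier G" "x [^] (p ^ k) = \<one>"
  shows "x \<in> N"
proof -
  have NG: "subgroup N G" using N normal_imp_subgroup by blast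
  have "order G \<noteq> 0" using fin order_gt_0_iff_finite by auto
  have "\<not> p dvd card (rcosets N)"
  proof
    assume "p dvd card (rcosets N)"
    then have "p ^ Suc (multiplicity p (order G)) dvd order G"
      using lagrange[OF NG] N(2) mult_dvd_mono[of p "card (rcosets N)" "card N" "card N"] by simp
    then show False using not_prime_power_Suc_multiplicity_dvd[OF p \<open>order G \<noteq> 0\<close>] by simp
  qed
  then have "coprime (p ^ k) (card (rcosets N))"
    using p by (simp add: prime_imp_coprime)
  then show ?thesis
    using subgroup_coprime_powers_mem[OF NG x(1) _ normal_pow_index[OF N(1) x(1)], of "p ^ k"] x(2)
      subgroup.one_closed[OF NG] by simp
qed

text \<open>The normalizer of \<open>P\<close> contains \<open>P\<close> and every Sylow subgroup
  for another prime, since those commute with \<open>P\<close> elementwise.\<close>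

lemma nilpotent_sylow_normal:
  assumes fin: "finite (carrier G)" and nil: "nilpotent_group G" and p: "Factorial_Ring.prime p"
    and P: "subgroup P G" "card P = p ^ multiplicity p (order G)"
  shows "P \<lhd> G"
proof (rule normal_if_normalizer_carrier[OF fin P(1)])
  have PG: "P \<subseteq> carrier G" using P subgroup.subset by blast
  have N: "subgroup (normalizer G P) G" by (rule normalizer_imp_subgroup[OF PG])
  show "normalizer G P = carrier G"
  proof (rule subgroup_eq_carrierI[OF fin N])
    fix t :: nat assume t: "Factorial_Ring.prime t"
    show "t ^ multiplicity t (order G) dvd card (normalizer G P)"
    proof (cases "t = p")
      case True
      then show ?thesis
        using card_subgroup_dvd_subgroup[OF P(1) N subset_normalizer[OF fin P(1)]] P by simp
    next
      case False
      obtain T where T: "subgroup T G" "card T = t ^ multiplicity t (order G)"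
        using sylow_subgroup_exists[OF fin t] .
      have "T \<subseteq> normalizer G P"
      proof
        fix u assume u: "u \<in> T"
        then have uc: "u \<in> carrier G" using subgroup.subset[OF T(1)] by blast
        have "u \<otimes> h \<otimes> inv u \<in> P" if h: "h \<in> P" for h
        proof -
          have hc: "h \<in> carrier G" using PG h by blast
          have "u \<otimes> h = h \<otimes> u"
            using nilpotent_coprime_commute[OF nil uc hc, of "card T" "card P"]
              subgroup_pow_card[OF T(1) u] subgroup_pow_card[OF P(1) h] T P t p False
            by (simp add: primes_coprime)
          then show ?thesis using h conjugate_eq_iff[OF uc hc hc] by simp
        qed
        then show "u \<in> normalizer G P" using uc by (simp add: mem_normalizer_iff[OF fin PG])
      qed
      then show ?thesis using card_subgroup_dvd_subgroup[OF T(1) N] T by simp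
    qed
  qed
qed

lemma conjugate_subgroup:
  assumes "subgroup R G" "g \<in> carrier G"
  shows "subgroup (g <# R #> inv g) G" "card (g <# R #> inv g) = card R"
proof -
  interpret act: group_action G "{H. subgroup H G}" "\<lambda>g. \<lambda>H \<in> {H. subgroup H G}. g <# H #> (inv g)"
    by (rule action_by_conjugation_on_subgroups_set)
  show "subgroup (g <# R #> inv g) G" using act.element_image[of g R] assms by simp
  have RG: "R \<subseteq> carrier G" using assms subgroup.subset by blast
  have "g <# R #> inv g = (\<lambda>h. g \<otimes> h \<otimes> inv g) ` R" by (auto simp: l_coset_def r_coset_def)
  moreover have "inj_on (\<lambda>h. g \<otimes> h \<otimes> inv g) R"
    using conjugation_is_inj[OF assms(2)] RG assms(2) by (auto simp: inj_on_def subset_iff)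
  ultimately show "card (g <# R #> inv g) = card R" by (simp add: card_image)
qed

text \<open>\<open>Q\<close> acts on the conjugates of \<open>R\<close>. Their number is prime to
  \<open>q\<close> while orbits have \<open>q\<close>-power length, so \<open>Q\<close> normalizes
  some conjugate, and a Sylow subgroup absorbs every \<open>q\<close>-subgroup normalizing
  it.\<close>

lemma sylow_conjugate:
  assumes fin: "finite (carrier G)" and q: "Factorial_Ring.prime q"
    and Q: "subgroup Q G" "card Q = q ^ k"
    and R: "subgroup R G" "card R = q ^ multiplicity q (order G)"
  obtains g where "g \<in> carrier G" "Q \<subseteq> g <# R #> inv g"
proof -
  let ?\<phi> = "\<lambda>g. \<lambda>H \<in> {H. H \<subseteq> carrier G}. g <# H #> inv g"
  have RG: "R \<subseteq> carrier G" using R subgroup.subset by blast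
  interpret act: group_action G "{H. H \<subseteq> carrier G}" ?\<phi> by (rule action_by_conjugation_on_power_set)
  interpret Qact: group_action "G\<lparr>carrier := Q\<rparr>" "{H. H \<subseteq> carrier G}" ?\<phi>
    by (rule act.induced_action[OF Q(1)])
  let ?T = "orbit G ?\<phi> R"
  have TE: "?T \<subseteq> {H. H \<subseteq> carrier G}" using act.element_image RG by (auto simp: orbit_def)
  have nR: "subgroup (normalizer G R) G" by (rule normalizer_imp_subgroup[OF RG])
  have "card ?T * card (normalizer G R) = order G"
    using act.orbit_stabilizer_theorem[of R] RG by (simp add: normalizer_def)
  moreover have "card R dvd card (normalizer G R)"
    by (rule card_subgroup_dvd_subgroup[OF R(1) nR subset_normalizer[OF fin R(1)]])
  ultimately have dv: "card ?T * card R dvd order G"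
    using mult_dvd_mono[of "card ?T" "card ?T" "card R" "card (normalizer G R)"] by simp
  have ord0: "order G \<noteq> 0" using fin order_gt_0_iff_finite by auto
  have ndvd: "\<not> q dvd card ?T"
  proof
    assume "q dvd card ?T"
    then have "q ^ Suc (multiplicity q (order G)) dvd order G"
      using dvd_trans[OF mult_dvd_mono[OF _ dvd_refl] dv] R(2) by simp
    then show False using not_prime_power_Suc_multiplicity_dvd[OF q ord0] by simp
  qed
  have "q dvd card ?T" if nofix: "\<And>H. H \<in> ?T \<Longrightarrow> \<not> Q \<subseteq> normalizer G H"
  proof (rule Qact.dvd_card_invariant_set[OF _ TE])
    show "finite {H. H \<subseteq> carrier G}" using fin by simp
    fix g H assume gH: "g \<in> carrier (G\<lparr>carrier := Q\<rparr>)" "H \<in> ?T"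
    then have g: "g \<in> carrier G" using subgroup.mem_carrier[OF Q(1)] by simp
    have H: "H \<in> {H. H \<subseteq> carrier G}" using TE gH by blast
    show "?\<phi> g H \<in> ?T"
    proof (rule act.orbit_trans[OF _ H _ gH(2)])
      show "?\<phi> g H \<in> {H. H \<subseteq> carrier G}" using act.element_image[OF g H] by blast
      show "?\<phi> g H \<in> orbit G ?\<phi> H" using g unfolding orbit_def by blast
    qed (use RG in simp)
  next
    fix H assume H: "H \<in> ?T"
    then have HG: "H \<subseteq> carrier G" using TE by blast
    have st: "stabilizer (G\<lparr>carrier := Q\<rparr>) ?\<phi> H = Q \<inter> normalizer G H"
      using subgroup.subset[OF Q(1)] by (auto simp: stabilizer_def normalizer_def)
    have eq: "card (orbit (G\<lparr>carrier := Q\<rparr>) ?\<phi> H) * card (stabilizer (G\<lparr>carrier := Q\<rparr>) ?\<phi> H) = q ^ k"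
      using Qact.orbit_stabilizer_theorem[of H] HG Q(2) by (simp add: order_def)
    show "q dvd card (orbit (G\<lparr>carrier := Q\<rparr>) ?\<phi> H)"
    proof (rule dvd_prime_power_nat[OF q])
      show "card (orbit (G\<lparr>carrier := Q\<rparr>) ?\<phi> H) dvd q ^ k" by (simp flip: eq)
      show "card (orbit (G\<lparr>carrier := Q\<rparr>) ?\<phi> H) \<noteq> 1"
      proof
        assume "card (orbit (G\<lparr>carrier := Q\<rparr>) ?\<phi> H) = 1"
        then have "stabilizer (G\<lparr>carrier := Q\<rparr>) ?\<phi> H = Q"
          using eq Q finite_subset[OF subgroup.subset[OF Q(1)] fin]
          by (intro card_subset_eq) (auto simp: st)
        then have "Q \<subseteq> normalizer G H"
          using st by blast
        then show False using nofix H by blast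
      qed
    qed
  qed
  then obtain H where H: "H \<in> ?T" "Q \<subseteq> normalizer G H" using ndvd by meson
  then obtain g where g: "g \<in> carrier G" "H = g <# R #> inv g" using RG by (auto simp: orbit_def)
  have Hs: "subgroup H G" "card H = card R" using conjugate_subgroup[OF R(1) g(1)] g by auto
  \<comment> \<open>Inside its normalizer \<open>H\<close> is a normal subgroup that still has the
    full \<open>q\<close>-part of the order, so \<open>normal_sylow_mem\<close> captures all of
    \<open>Q\<close>.\<close>
  let ?N = "normalizer G H"
  have N: "subgroup ?N G" by (rule normalizer_imp_subgroup[OF subgroup.subset[OF Hs(1)]])
  interpret N: group "G\<lparr>carrier := ?N\<rparr>" by (rule subgroup_imp_group[OF N])
  have HN: "H \<subseteq> ?N" by (rule subset_normalizer[OF fin Hs(1)])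
  have norm: "H \<lhd> G\<lparr>carrier := ?N\<rparr>"
  proof (rule N.normal_invI[OF subgroup_incl[OF Hs(1) N HN]])
    fix x h assume "x \<in> carrier (G\<lparr>carrier := ?N\<rparr>)" "h \<in> H"
    then show "x \<otimes>\<^bsub>G\<lparr>carrier := ?N\<rparr>\<^esub> h \<otimes>\<^bsub>G\<lparr>carrier := ?N\<rparr>\<^esub> inv\<^bsub>G\<lparr>carrier := ?N\<rparr>\<^esub> x \<in> H"
      using N mem_normalizer_iff[OF fin subgroup.subset[OF Hs(1)]] by simp
  qed
  have "multiplicity q (order (G\<lparr>carrier := ?N\<rparr>)) = multiplicity q (order G)"
  proof (rule antisym)
    have "card ?N \<noteq> 0" using subgroup.finite_imp_card_positive[OF N fin] by simp
    then show "multiplicity q (order G) \<le> multiplicity q (order (G\<lparr>carrier := ?N\<rparr>))"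
      using card_subgroup_dvd_subgroup[OF Hs(1) N HN] Hs(2) R(2) q
      by (intro multiplicity_geI) (auto simp: order_def)
    show "multiplicity q (order (G\<lparr>carrier := ?N\<rparr>)) \<le> multiplicity q (order G)"
      using card_subgroup_dvd[OF N] ord0 by (intro dvd_imp_multiplicity_le) (auto simp: order_def)
  qed
  then have cH: "card H = q ^ multiplicity q (order (G\<lparr>carrier := ?N\<rparr>))" using Hs R by simp
  have "Q \<subseteq> H"
  proof
    fix x assume x: "x \<in> Q"
    have "x [^]\<^bsub>G\<lparr>carrier := ?N\<rparr>\<^esub> (q ^ k) = \<one>\<^bsub>G\<lparr>carrier := ?N\<rparr>\<^esub>"
      using subgroup_pow_card[OF Q(1) x] Q(2) by (simp add: nat_pow_consistent[symmetric])
    then show "x \<in> H"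
      using N.normal_sylow_mem[OF _ norm cH q, of x k] x H(2) finite_subset[OF subgroup.subset[OF N] fin] by auto
  qed
  then show thesis using that g by blast
qed

text \<open>For normal \<open>N\<close> this is the subgroup generated by \<open>N\<close> and
  \<open>x\<close>. Taking it as a preimage from the quotient makes its order the order of the coset
  times the order of \<open>N\<close>.\<close>

definition cyclic_extension :: "'a set \<Rightarrow> 'a \<Rightarrow> 'a set" where
  "cyclic_extension N x = \<Union> (generate (G Mod N) {N #> x})"

lemma cyclic_extension:
  assumes fin: "finite (carrier G)" and N: "N \<lhd> G" and x: "x \<in> carrier G"
  shows "subgroup (cyclic_extension N x) G" (is ?thesis1)
    and "N \<subseteq> cyclic_extension N x" (is ?thesis2)
    and "x \<in> cyclic_extension N x" (is ?thesis3)
    and "\<And>H. \<lbrakk>subgroup H G; N \<subseteq> H; x \<in> H\<rbrakk> \<Longrightarrow> cyclic_extension N x \<subseteq> H"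
    and "card (cyclic_extension N x) = group.ord (G Mod N) (N #> x) * card N" (is ?thesis5)
proof -
  interpret N: normal N G by fact
  interpret Q: group "G Mod N" by (rule N.factorgroup_is_group)
  let ?u = "N #> x" and ?A = "generate (G Mod N) {N #> x}"
  have uc: "?u \<in> carrier (G Mod N)" using x by (auto simp: carrier_FactGroup)
  have A: "subgroup ?A (G Mod N)" using uc by (intro Q.generate_is_subgroup) auto
  show K: ?thesis1 unfolding cyclic_extension_def by (rule N.factgroup_subgroup_union_subgroup[OF A])
  have mem: "cyclic_extension N x = {y \<in> carrier G. N #> y \<in> ?A}"
    unfolding cyclic_extension_def by (rule N.factgroup_subgroup_union_char[OF A])
  have "N \<in> ?A" using subgroup.one_closed[OF A] by simp
  then show NK: ?thesis2 unfolding mem using N.subset N.is_subgroup by (auto simp: coset_join2)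
  show ?thesis3 unfolding mem using x by (simp add: generate.incl)
  have finQ: "finite (carrier (G Mod N))" using fin by (simp add: carrier_FactGroup)
  show "cyclic_extension N x \<subseteq> H" if H: "subgroup H G" "N \<subseteq> H" "x \<in> H" for H
  proof
    fix y assume "y \<in> cyclic_extension N x"
    then have y: "y \<in> carrier G" "N #> y \<in> ?A" unfolding mem by auto
    then obtain k :: nat where "N #> y = ?u [^]\<^bsub>G Mod N\<^esub> k"
      using Q.generate_pow_on_finite_carrier[OF finQ uc] by auto
    then have "N #> y = N #> (x [^] k)" using x by (simp add: N.FactGroup_pow)
    then have "y \<in> N #> (x [^] k)" using y N.is_subgroup rcos_self by blast
    then obtain n where "n \<in> N" "y = n \<otimes> x [^] k" by (auto simp: r_coset_def)
    moreover have "x [^] k \<in> H" using H by (metis subgroup_int_pow_closed int_pow_int)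
    ultimately show "y \<in> H" using H subgroup.m_closed[OF H(1)] by blast
  qed
  let ?K = "cyclic_extension N x"
  interpret K: group "G\<lparr>carrier := ?K\<rparr>" by (rule subgroup_imp_group[OF K])
  have "?A = rcosets\<^bsub>G\<lparr>carrier := ?K\<rparr>\<^esub> N"
    unfolding cyclic_extension_def by (rule N.factgroup_subgroup_union_factor[OF A])
  then show ?thesis5
    using K.lagrange[OF subgroup_incl[OF N.is_subgroup K NK]] Q.generate_pow_card[OF uc]
    by (simp add: order_def)
qed

end

subsection \<open>Equally partitioned groups\<close>

context group begin

text \<open>Cauchy's theorem for \<open>H\<close>: Sylow existence for the exponent 1 gives a
  subgroup of order exactly \<open>t\<close>, whose non-identity elements have order
  \<open>t\<close>.\<close>

lemma cauchy_subgroup: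
  assumes fin: "finite (carrier G)" and H: "subgroup H G"
    and t: "Factorial_Ring.prime t" "t dvd card H"
  obtains y where "y \<in> H" "ord y = t"
proof -
  interpret H: group "G\<lparr>carrier := H\<rparr>" by (rule subgroup_imp_group[OF H])
  have "order (G\<lparr>carrier := H\<rparr>) = t ^ 1 * (card H div t)" using t by (simp add: order_def)
  moreover have "finite (carrier (G\<lparr>carrier := H\<rparr>))"
    using finite_subset[OF subgroup.subset[OF H] fin] by simp
  ultimately obtain K where K: "subgroup K (G\<lparr>carrier := H\<rparr>)" "card K = t"
    using sylow_thm[OF t(1) H.is_group] by (metis power_one_right)
  have "K \<noteq> {\<one>}" using K(2) t(1) by auto
  moreover have "\<one> \<in> K" using subgroup.one_closed[OF K(1)] by simp
  ultimately obtain y where y: "y \<in> K" "y \<noteq> \<one>" by blast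
  have KG: "subgroup K G" by (rule incl_subgroup[OF H K(1)])
  have yc: "y \<in> carrier G" using subgroup.mem_carrier[OF KG y(1)] .
  have "ord y dvd t" using subgroup_pow_card[OF KG y(1)] K(2) pow_eq_id[OF yc] by simp
  then have "ord y = t" using t(1) y(2) ord_eq_1[OF yc] by (metis One_nat_def prime_nat_iff)
  moreover have "y \<in> H" using y subgroup.mem_carrier[OF K(1)] by simp
  ultimately show thesis using that by blast
qed

lemma ord_conjugate:
  assumes "a \<in> carrier G" "x \<in> carrier G"
  shows "ord (a \<otimes> x \<otimes> inv a) = ord x"
proof -
  have "(a \<otimes> x \<otimes> inv a) [^] n = \<one> \<longleftrightarrow> ord x dvd n" for n :: nat
    using assms conjugate_eq_iff[of a "x [^] n" \<one>] pow_eq_id[of x n]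
    by (simp add: pow_conjugate)
  then show ?thesis using assms ord_unique[of "a \<otimes> x \<otimes> inv a"] by simp
qed

end

locale equal_partition = group +
  fixes P
  assumes finite_carrier: "finite (carrier G)"
    and part: "ES_partition G {\<one>} P"
begin

text \<open>The choice is immaterial: by \<open>card_component\<close> every component has this
  order, the h of the overview.\<close>

abbreviation "component_order \<equiv> card (SOME H. H \<in> P)"

lemma component_subgroup: "H \<in> P \<Longrightarrow> subgroup H G"
  and component_proper: "H \<in> P \<Longrightarrow> H \<noteq> carrier G"
  and components_cover: "carrier G = \<Union> P"
  and components_disjoint: "\<lbrakk>H \<in> P; K \<in> P; H \<noteq> K\<rbrakk> \<Longrightarrow> H \<inter> K = {\<one>}"
  and components_finite: "finite P"
  using part by (auto simp: ES_partition_def strict_partition_def proper_subgroup_def)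

lemma component_subset: "H \<in> P \<Longrightarrow> H \<subseteq> carrier G"
  by (rule subgroup.subset[OF component_subgroup])

lemma components_nonempty: "P \<noteq> {}"
  using components_cover by auto

lemma card_component: "H \<in> P \<Longrightarrow> card H = component_order"
  using part components_nonempty someI_ex[of "\<lambda>H. H \<in> P"]
  unfolding ES_partition_def by blast

lemma card_eq_sum_components:
  assumes "F \<subseteq> carrier G - {\<one>}"
  shows "card F = (\<Sum>H\<in>P. card (F \<inter> H))"
proof -
  have "F = (\<Union>H\<in>P. F \<inter> H)" using assms components_cover by auto
  moreover have "card (\<Union>H\<in>P. F \<inter> H) = (\<Sum>H\<in>P. card (F \<inter> H))"
  proof (rule card_UN_disjoint[OF components_finite])
    show "\<forall>H\<in>P. finite (F \<inter> H)"
      using finite_subset[OF assms] finite_carrier by simp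
    show "\<forall>H\<in>P. \<forall>K\<in>P. H \<noteq> K \<longrightarrow> F \<inter> H \<inter> (F \<inter> K) = {}"
    proof (intro ballI impI)
      fix H K assume "H \<in> P" "K \<in> P" "H \<noteq> K"
      then have "H \<inter> K = {\<one>}" by (rule components_disjoint)
      then show "F \<inter> H \<inter> (F \<inter> K) = {}" using assms by blast
    qed
  qed
  ultimately show ?thesis by simp
qed

lemma component_order_pos: "component_order > 0"
  using components_nonempty subgroup.finite_imp_card_positive[OF component_subgroup finite_carrier]
  by (simp add: some_in_eq)

lemma order_minus_one: "order G - 1 = card P * (component_order - 1)"
proof -
  have "order G - 1 = card (carrier G - {\<one>})"
    using finite_carrier by (simp add: order_def)
  also have "\<dots> = (\<Sum>H\<in>P. card ((carrier G - {\<one>}) \<inter> H))"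
    by (rule card_eq_sum_components) simp
  also have "\<dots> = (\<Sum>H\<in>P. component_order - 1)"
  proof (rule sum.cong[OF refl])
    fix H assume H: "H \<in> P"
    have "(carrier G - {\<one>}) \<inter> H = H - {\<one>}" using component_subset[OF H] by blast
    then show "card ((carrier G - {\<one>}) \<inter> H) = component_order - 1"
      using card_component[OF H] subgroup.one_closed[OF component_subgroup[OF H]]
        finite_subset[OF component_subset[OF H] finite_carrier] by simp
  qed
  finally show ?thesis by simp
qed

text \<open>Comparing h m - 1 = m (h - 1) + (m - 1) with \<open>order_minus_one\<close> shows that h
  - 1 divides m - 1, and m - 1 is positive because components are proper.\<close>

lemma component_index:
  obtains m where "order G = component_order * m" "component_order \<le> m" "1 < m"
proof -
  let ?h = component_order
  obtain H where H: "H \<in> P" using components_nonempty by blast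
  have "?h dvd order G"
    using card_subgroup_dvd[OF component_subgroup[OF H]] card_component[OF H] by simp
  then obtain m where m: "order G = ?h * m" by blast
  have "?h < order G"
    using psubset_card_mono[OF finite_carrier, of H] component_subset[OF H] component_proper[OF H]
      card_component[OF H] by (auto simp: order_def)
  then have "m \<noteq> 0" "m \<noteq> 1" using m by auto
  then have m1: "1 < m" by simp
  have "k * l - 1 = l * (k - 1) + (l - 1)" if "0 < k" "0 < l" for k l :: nat
  proof -
    have "k * l = l * (k - 1) + l" using that by (cases k) (simp_all add: algebra_simps)
    then show ?thesis using that by simp
  qed
  from this[of ?h m] have "?h * m - 1 = m * (?h - 1) + (m - 1)"
    using m1 component_order_pos by simp
  then have "card P * (?h - 1) = m * (?h - 1) + (m - 1)" using order_minus_one m by simp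
  then have "(?h - 1) dvd (m - 1)" by (metis dvd_add_right_iff dvd_triv_right)
  then have "?h - 1 \<le> m - 1" using m1 by (intro dvd_imp_le) auto
  then show thesis using that m m1 component_order_pos by simp
qed

lemma coprime_card_partition: "coprime (card P) (order G)"
proof (rule coprimeI)
  fix d assume d: "d dvd card P" "d dvd order G"
  have "order G > 0" using finite_carrier order_gt_0_iff_finite by blast
  then have "order G = card P * (component_order - 1) + 1" using order_minus_one by simp
  then show "is_unit d" using d by (metis dvd_add_right_iff dvd_mult2)
qed

text \<open>Modulo the component order, \<open>card (F \<inter> H)\<close> agrees with
  \<open>card F\<close>. The identity lies in \<open>H\<close> but not in \<open>F\<close>, so the
  intersection is smaller than \<open>H\<close> and its size is exactly that residue, the same for
  every component.\<close>

lemma equidistributed: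
  assumes F: "F \<subseteq> carrier G - {\<one>}" and dvd: "\<And>H. H \<in> P \<Longrightarrow> component_order dvd card (F - H)"
  obtains f where "f < component_order" "card F = card P * f"
proof -
  have "card (F \<inter> H) = card F mod component_order" if H: "H \<in> P" for H
  proof -
    have fF: "finite F" using F finite_carrier finite_subset by blast
    have "card F = card (F \<inter> H) + card (F - H)"
      using card_Un_disjoint[of "F \<inter> H" "F - H"] fF by (simp add: Int_Diff_Un Int_Diff_disjoint)
    then have "card F mod component_order = card (F \<inter> H) mod component_order"
      using dvd[OF H] by auto
    moreover have "card (F \<inter> H) < card H"
      using F subgroup.one_closed[OF component_subgroup[OF H]]
        finite_subset[OF component_subset[OF H] finite_carrier] by (intro psubset_card_mono) auto
    ultimately show ?thesis using card_component[OF H] by simp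
  qed
  then have "(\<Sum>H\<in>P. card (F \<inter> H)) = card P * (card F mod component_order)" by simp
  then show thesis
    by (intro that[OF mod_less_divisor[OF component_order_pos]] trans[OF card_eq_sum_components[OF F]])
qed

text \<open>The product of \<open>x\<close> and \<open>y\<close> lies in a third component
  \<open>L\<close>. If the \<open>n\<close>-th power of \<open>x\<close> is trivial, the
  \<open>n\<close>-th power of the product equals that of \<open>y\<close> and lies in
  \<open>K\<close> and \<open>L\<close>, which meet trivially.\<close>

lemma commuting_pow_eq_one_iff:
  assumes HK: "H \<in> P" "K \<in> P" "H \<noteq> K" and x: "x \<in> H" "x \<noteq> \<one>" and y: "y \<in> K" "y \<noteq> \<one>"
    and comm: "x \<otimes> y = y \<otimes> x"
  shows "x [^] (n::nat) = \<one> \<longleftrightarrow> y [^] n = \<one>"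
proof -
  have subH: "subgroup H G" and subK: "subgroup K G" using HK component_subgroup by auto
  have c: "x \<in> carrier G" "y \<in> carrier G" using x y component_subset HK by blast+
  obtain L where L: "L \<in> P" "x \<otimes> y \<in> L" using components_cover c by (metis UnionE m_closed)
  have subL: "subgroup L G" using L component_subgroup by auto
  have xyH: "x \<otimes> y \<notin> H"
  proof
    assume "x \<otimes> y \<in> H"
    then have "inv x \<otimes> (x \<otimes> y) \<in> H" using subH x subgroup.m_closed subgroup.m_inv_closed by metis
    then have "y \<in> H" using c by simp
    then show False using components_disjoint[OF HK] y by blast
  qed
  have xyK: "x \<otimes> y \<notin> K"
  proof
    assume "x \<otimes> y \<in> K"
    then have "x \<otimes> y \<otimes> inv y \<in> K" using subK y subgroup.m_closed subgroup.m_inv_closed by metis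
    then have "x \<in> K" using c by (simp add: m_assoc)
    then show False using components_disjoint[OF HK] x by blast
  qed
  have pow: "u [^] n \<in> U" if "subgroup U G" "u \<in> U" for U u
    using that by (metis int_pow_int subgroup_int_pow_closed)
  have xyn: "x [^] n \<otimes> y [^] n \<in> L"
    using pow[OF subL L(2)] pow_mult_distrib[OF comm c] by simp
  show ?thesis
  proof
    assume "x [^] n = \<one>"
    then have "y [^] n \<in> K \<inter> L" using xyn pow[OF subK y(1)] c by simp
    then show "y [^] n = \<one>" using components_disjoint[OF HK(2) L(1)] xyK L by blast
  next
    assume "y [^] n = \<one>"
    then have "x [^] n \<in> H \<inter> L" using xyn pow[OF subH x(1)] c by simp
    then show "x [^] n = \<one>" using components_disjoint[OF HK(1) L(1)] xyH L by blast
  qed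
qed

text \<open>A non-trivial power of \<open>x\<close> satisfies the same hypotheses with the same
  \<open>y\<close>, so it has the order of \<open>y\<close>, hence that of \<open>x\<close>. For a
  prime \<open>r\<close> dividing the order, the \<open>r\<close>-th power has smaller order, so it
  must be trivial.\<close>

lemma commuting_imp_prime_order:
  assumes HK: "H \<in> P" "K \<in> P" "H \<noteq> K" and x: "x \<in> H" "x \<noteq> \<one>" and y: "y \<in> K" "y \<noteq> \<one>"
    and comm: "x \<otimes> y = y \<otimes> x"
  shows "Factorial_Ring.prime (ord x)"
proof -
  have c: "x \<in> carrier G" "y \<in> carrier G" using x y component_subset HK by blast+
  have "ord x \<noteq> 1" using ord_eq_1[OF c(1)] x by simp
  then obtain r where r: "Factorial_Ring.prime r" "r dvd ord x" using prime_factor_nat by blast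
  have "x [^] r = \<one>"
  proof (rule ccontr)
    assume ne: "x [^] r \<noteq> \<one>"
    have xr: "x [^] r \<in> H" by (metis int_pow_int subgroup_int_pow_closed x(1) component_subgroup[OF HK(1)])
    have "x [^] r \<otimes> y = y \<otimes> x [^] r" using group_commutes_pow[OF comm c] by simp
    then have "(x [^] r) [^] n = \<one> \<longleftrightarrow> x [^] n = \<one>" for n :: nat
      using commuting_pow_eq_one_iff[OF HK xr ne y] commuting_pow_eq_one_iff[OF HK x y comm] by simp
    then have "ord x dvd ord x div r"
      using c r pow_eq_id[OF c(1)] by (metis nat_pow_pow pow_ord_eq_1 dvd_mult_div_cancel)
    moreover have "ord x > 0" using ord_ge_1[OF finite_carrier c(1)] by simp
    ultimately have "ord x \<le> ord x div r" using r
      by (intro dvd_imp_le) (auto simp: dvd_div_eq_0_iff)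
    then show False using \<open>ord x > 0\<close> r(1) prime_gt_1_nat[of r] by (metis div_less_dividend leD)
  qed
  then have "ord x dvd r" using pow_eq_id[OF c(1)] by simp
  then show ?thesis using r by (metis dvd_antisym)
qed

text \<open>With \<open>F\<close> the non-identity elements of non-prime order, the index m of a
  component divides \<open>card F\<close> and hence the common intersection size f. But f < h <= m,
  so f = 0 and \<open>F\<close> is empty.\<close>

lemma all_orders_prime:
  assumes "x \<in> carrier G" "x \<noteq> \<one>"
  shows "Factorial_Ring.prime (ord x)"
proof -
  define F where "F = {x \<in> carrier G. x \<noteq> \<one> \<and> \<not> Factorial_Ring.prime (ord x)}"
  have FG: "F \<subseteq> carrier G - {\<one>}" by (auto simp: F_def)
  have conj: "a \<otimes> x \<otimes> inv a \<in> F" if "a \<in> carrier G" "x \<in> F" for a x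
    using that conjugate_eq_iff[of a x \<one>] by (auto simp: F_def ord_conjugate)
  \<comment> \<open>Commuting across components forces prime order, so the centralizer of an element
    of \<open>F\<close> stays inside the component of that element.\<close>
  have centr: "c \<in> H" if x: "x \<in> F" "x \<in> H" and H: "H \<in> P" and c: "c \<in> centralizer x" for c x H
  proof (rule ccontr)
    assume "c \<notin> H"
    obtain K where "K \<in> P" "c \<in> K" using components_cover c by auto
    moreover have "c \<noteq> \<one>" using \<open>c \<notin> H\<close> subgroup.one_closed[OF component_subgroup[OF H]] by auto
    ultimately have "Factorial_Ring.prime (ord x)"
      using commuting_imp_prime_order[of H K x c] x H c \<open>c \<notin> H\<close> by (auto simp: F_def)
    then show False using x by (simp add: F_def)
  qed
  \<comment> \<open>An element of \<open>F\<close> outside \<open>H\<close> has its centralizer in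
    another component, which meets \<open>H\<close> trivially; so the orbits of \<open>H\<close> on
    \<open>F - H\<close> are regular.\<close>
  have "component_order dvd card (F - H)" if H: "H \<in> P" for H
  proof (rule dvd_card_conjugation_invariant[OF finite_carrier component_subgroup[OF H]])
    have sub: "subgroup H G" by (rule component_subgroup[OF H])
    show "F - H \<subseteq> carrier G" using FG by blast
    fix a x assume a: "a \<in> H" "x \<in> F - H"
    have c: "a \<in> carrier G" "x \<in> carrier G" using a component_subset[OF H] FG by blast+
    have "a \<otimes> x \<otimes> inv a \<notin> H"
    proof
      assume "a \<otimes> x \<otimes> inv a \<in> H"
      then have "inv a \<otimes> (a \<otimes> x \<otimes> inv a) \<otimes> a \<in> H"
        using a sub subgroup.m_closed subgroup.m_inv_closed by metis
      then show False using a c by (simp add: m_assoc)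
    qed
    then show "a \<otimes> x \<otimes> inv a \<in> F - H" using conj c a by blast
  next
    fix x k assume x: "x \<in> F - H" and k: "k * card (H \<inter> centralizer x) = card H"
    obtain K where K: "K \<in> P" "x \<in> K" using components_cover x FG by blast
    then have "H \<inter> centralizer x \<subseteq> {\<one>}"
      using centr[of x K] components_disjoint[OF H K(1)] x by blast
    moreover have "\<one> \<in> H \<inter> centralizer x"
      using subgroup.one_closed[OF component_subgroup[OF H]] x FG by auto
    ultimately have "H \<inter> centralizer x = {\<one>}" by blast
    then show "component_order dvd k" using k card_component[OF H] by simp
  qed
  then obtain f where f: "f < component_order" "card F = card P * f"
    using equidistributed[OF FG] by blast
  obtain m where m: "order G = component_order * m" "component_order \<le> m" "1 < m"
    using component_index .
  \<comment> \<open>The centralizer of an element of \<open>F\<close> is a subgroup of a component,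
    so the length of its class is a multiple of the index m.\<close>
  have "m dvd card F"
  proof (rule dvd_card_conjugation_invariant[OF finite_carrier subgroup_self _ conj])
    fix x k assume x: "x \<in> F" and k: "k * card (carrier G \<inter> centralizer x) = card (carrier G)"
    obtain H where H: "H \<in> P" "x \<in> H" using components_cover x FG by blast
    have xc: "x \<in> carrier G" using x FG by blast
    have "centralizer x \<subseteq> H" using centr[OF x H(2,1)] by blast
    then have "card (centralizer x) dvd card H"
      using card_subgroup_dvd_subgroup[OF centralizer_subgroup[OF xc] component_subgroup[OF H(1)]] by blast
    then obtain l where l: "component_order = card (centralizer x) * l" using card_component[OF H(1)] by auto
    have "carrier G \<inter> centralizer x = centralizer x" by blast
    then have "card (centralizer x) * k = card (centralizer x) * (l * m)"
      using k m(1) l by (simp add: order_def mult_ac)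
    moreover have "card (centralizer x) \<noteq> 0" using l component_order_pos by auto
    ultimately show "m dvd k" by simp
  qed (use FG in auto)
  moreover have "coprime m (card P)"
    using coprime_card_partition m(1) by (metis coprime_commute coprime_mult_right_iff)
  ultimately have "m dvd f" using f(2) by (simp add: coprime_dvd_mult_right_iff)
  then have "f = 0" using f(1) m(2) by (meson dvd_imp_le gr0I leD le_trans not_le)
  moreover have "finite F" using finite_subset[OF FG] finite_carrier by simp
  ultimately have "F = {}" using f(2) by simp
  then show ?thesis using assms by (auto simp: F_def)
qed

text \<open>A common prime t would differ from \<open>ord x\<close> and, by Cauchy, be the order of
  some \<open>y\<close> commuting with \<open>x\<close>. The product of \<open>x\<close> and
  \<open>y\<close> would have order dividing \<open>ord x * t\<close> but neither factor, which is
  impossible for a prime order.\<close>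

lemma coprime_card_centralizer:
  assumes x: "x \<in> carrier G" "x \<noteq> \<one>" and A: "subgroup A G" and d: "\<not> ord x dvd d"
  shows "coprime d (card (A \<inter> centralizer x))"
proof (rule ccontr)
  assume "\<not> coprime d (card (A \<inter> centralizer x))"
  then obtain t where t: "Factorial_Ring.prime t" "t dvd d" "t dvd card (A \<inter> centralizer x)"
    using prime_factor_nat[of "gcd d (card (A \<inter> centralizer x))"] by (auto simp: coprime_iff_gcd_eq_1)
  obtain y where y: "y \<in> A \<inter> centralizer x" "ord y = t"
    using cauchy_subgroup[OF finite_carrier subgroups_Inter_pair[OF A centralizer_subgroup[OF x(1)]] t(1,3)] .
  have yc: "y \<in> carrier G" "x \<otimes> y = y \<otimes> x" using y by auto
  have p: "Factorial_Ring.prime (ord x)" by (rule all_orders_prime[OF x])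
  have tp: "t \<noteq> ord x" using t d by auto
  have pow: "(x \<otimes> y) [^] n = x [^] n \<otimes> y [^] n" for n :: nat
    by (rule pow_mult_distrib[OF yc(2) x(1) yc(1)])
  have nd: "\<not> t dvd ord x" "\<not> ord x dvd t" using primes_dvd_imp_eq p t(1) tp by metis+
  have "(x \<otimes> y) [^] ord x \<noteq> \<one>"
    using pow[of "ord x"] x yc(1) y(2) pow_eq_id[OF yc(1)] nd by simp
  moreover have "(x \<otimes> y) [^] t \<noteq> \<one>"
    using pow[of t] x yc(1) y(2) pow_eq_id[OF yc(1), of t] pow_eq_id[OF x(1), of t] nd by simp
  moreover have "ord (x \<otimes> y) dvd ord x * t" using ord_mul_divides[OF yc(2) x(1) yc(1)] y(2) by simp
  moreover have xyc: "x \<otimes> y \<in> carrier G" using x yc by simp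
  moreover have "x \<otimes> y \<noteq> \<one>" using calculation(1) by auto
  ultimately show False
    using all_orders_prime[OF xyc] pow_eq_id[OF xyc] prime_dvd_mult_iff by blast
qed

text \<open>Here the set to be counted consists of the elements of order \<open>p\<close>. Their
  centralizers have order prime to \<open>g'\<close>, so \<open>g'\<close> divides each class length
  and hence the common intersection size f, which is non-zero by Cauchy and below the component
  order.\<close>

lemma prime_complement_less_component_order:
  assumes p: "Factorial_Ring.prime p" "p dvd order G" and g: "order G = p ^ b * g'" "\<not> p dvd g'"
  shows "g' < component_order"
proof -
  define E where "E = {x \<in> carrier G. ord x = p}"
  have EG: "E \<subseteq> carrier G - {\<one>}" using p by (auto simp: E_def)
  have conj: "a \<otimes> x \<otimes> inv a \<in> E" if "a \<in> carrier G" "x \<in> E" for a x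
    using that by (auto simp: E_def ord_conjugate)
  obtain m where m: "order G = component_order * m" "component_order \<le> m" "1 < m"
    using component_index .
  have "component_order \<noteq> 0" using component_order_pos by simp
  then obtain a h' where h: "component_order = p ^ a * h'" "\<not> p dvd h'"
    using multiplicity_decompose'[of component_order p] p(1) by (metis not_prime_unit)
  have "component_order dvd card (E - H)" if H: "H \<in> P" for H
  proof -
    have sub: "subgroup H G" by (rule component_subgroup[OF H])
    have notH: "c \<otimes> x \<otimes> inv c \<notin> H" if c: "c \<in> H" "x \<in> carrier G - H" for c x
    proof
      assume "c \<otimes> x \<otimes> inv c \<in> H"
      then have "inv c \<otimes> (c \<otimes> x \<otimes> inv c) \<otimes> c \<in> H"
        using c sub subgroup.m_closed subgroup.m_inv_closed by metis
      then show False using c subgroup.mem_carrier[OF sub c(1)] by (simp add: m_assoc)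
    qed
    \<comment> \<open>The component order is treated in two coprime pieces. The part prime to
      \<open>p\<close> divides the orbit lengths directly, because centralizers of elements of order
      \<open>p\<close> have order prime to it.\<close>
    have h'dvd: "h' dvd card (E - H)"
    proof (rule dvd_card_conjugation_invariant[OF finite_carrier sub])
      show "c \<otimes> x \<otimes> inv c \<in> E - H" if "c \<in> H" "x \<in> E - H" for c x
        using that conj[of c x] notH[of c x] subgroup.mem_carrier[OF sub] EG by blast
      fix x k assume x: "x \<in> E - H" and k: "k * card (H \<inter> centralizer x) = card H"
      have "coprime h' (card (H \<inter> centralizer x))"
        using x EG h(2) by (intro coprime_card_centralizer sub) (auto simp: E_def)
      moreover have "h' dvd k * card (H \<inter> centralizer x)" using k card_component[OF H] h(1) by simp
      ultimately show "h' dvd k" by (simp add: coprime_dvd_mult_left_iff)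
    qed (use EG in blast)
    \<comment> \<open>For the \<open>p\<close>-part count the complement of \<open>E\<close>
      instead: an element outside \<open>H\<close> and \<open>E\<close> has a prime order other than
      \<open>p\<close>, so its centralizer in \<open>H\<close> has order prime to \<open>p\<close>.
      Since \<open>p ^ a\<close> divides the size of \<open>carrier G - H\<close>, it then also
      divides that of \<open>E - H\<close>.\<close>
    let ?T = "carrier G - H - E"
    have "p ^ a dvd card ?T"
    proof (rule dvd_card_conjugation_invariant[OF finite_carrier sub])
      show "c \<otimes> x \<otimes> inv c \<in> ?T" if "c \<in> H" "x \<in> ?T" for c x
        using that notH[of c x] subgroup.mem_carrier[OF sub, of c] by (auto simp: E_def ord_conjugate)
      fix x k assume x: "x \<in> ?T" and k: "k * card (H \<inter> centralizer x) = card H"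
      have x1: "x \<noteq> \<one>" using x subgroup.one_closed[OF sub] by blast
      then have q: "Factorial_Ring.prime (ord x)" using x all_orders_prime by blast
      have "\<not> ord x dvd p ^ a"
      proof
        assume "ord x dvd p ^ a"
        then have "ord x = p" using q p(1) by (metis prime_dvd_power primes_dvd_imp_eq)
        then show False using x by (auto simp: E_def)
      qed
      then have "coprime (p ^ a) (card (H \<inter> centralizer x))"
        using x x1 by (intro coprime_card_centralizer sub) auto
      moreover have "p ^ a dvd k * card (H \<inter> centralizer x)" using k card_component[OF H] h(1) by simp
      ultimately show "p ^ a dvd k" by (simp only: coprime_dvd_mult_left_iff)
    qed blast
    moreover have "card (carrier G - H) = card (E - H) + card ?T"
    proof -
      have "carrier G - H = (E - H) \<union> ?T" using EG by blast
      then show ?thesis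
        using card_Un_disjoint[of "E - H" ?T] finite_carrier finite_subset[of "E - H" "carrier G"] EG by force
    qed
    moreover have "p ^ a dvd card (carrier G - H)"
    proof -
      have "card (carrier G - H) = component_order * m - component_order"
        using m(1) card_component[OF H] card_Diff_subset[OF finite_subset[OF component_subset[OF H] finite_carrier] component_subset[OF H]]
        by (simp add: order_def)
      then show ?thesis using h(1) by simp
    qed
    ultimately have "p ^ a dvd card (E - H)" by (simp add: dvd_add_left_iff)
    moreover have "coprime (p ^ a) h'" using h(2) p(1) by (simp add: prime_imp_coprime)
    ultimately show ?thesis using h'dvd h(1) by (simp add: divides_mult)
  qed
  then obtain f where f: "f < component_order" "card E = card P * f"
    using equidistributed[OF EG] by blast
  have "g' dvd card E"
  proof (rule dvd_card_conjugation_invariant[OF finite_carrier subgroup_self _ conj])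
    fix x k assume x: "x \<in> E" and k: "k * card (carrier G \<inter> centralizer x) = card (carrier G)"
    have "coprime g' (card (carrier G \<inter> centralizer x))"
      using x EG g(2) by (intro coprime_card_centralizer subgroup_self) (auto simp: E_def)
    moreover have "g' dvd k * card (carrier G \<inter> centralizer x)" using k g(1) by (simp add: order_def)
    ultimately show "g' dvd k" by (simp only: coprime_dvd_mult_left_iff)
  qed (use EG in auto)
  moreover have "coprime g' (card P)"
    using coprime_card_partition g(1) by (metis coprime_commute coprime_mult_right_iff)
  ultimately have "g' dvd f" using f(2) by (simp add: coprime_dvd_mult_right_iff)
  moreover have "f \<noteq> 0"
  proof -
    obtain y where "y \<in> carrier G" "ord y = p"
      using cauchy_subgroup[OF finite_carrier subgroup_self p(1)] p(2) by (auto simp: order_def)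
    then have "E \<noteq> {}" by (auto simp: E_def)
    moreover have "finite E" using finite_subset[OF EG] finite_carrier by simp
    ultimately show ?thesis using f(2) by auto
  qed
  ultimately show ?thesis using f(1) by (meson dvd_imp_le gr0I le_less_trans)
qed

theorem order_prime_power:
  obtains p k where "Factorial_Ring.prime (p::nat)" "order G = p ^ k"
proof -
  obtain m where m: "order G = component_order * m" "component_order \<le> m" "1 < m"
    using component_index .
  have g0: "order G \<noteq> 0" using finite_carrier order_gt_0_iff_finite by auto
  have "order G \<noteq> 1" using m by auto
  then obtain p where p: "Factorial_Ring.prime p" "p dvd order G" using prime_factor_nat by blast
  obtain b g' where g: "order G = p ^ b * g'" "\<not> p dvd g'"
    using multiplicity_decompose'[of "order G" p] g0 p(1) by (metis not_prime_unit)
  have "g' = 1"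
  proof (rule ccontr)
    assume "g' \<noteq> 1"
    then obtain q where q: "Factorial_Ring.prime q" "q dvd g'" using prime_factor_nat by blast
    have qG: "q dvd order G" using q g(1) by simp
    obtain c k' where k: "order G = q ^ c * k'" "\<not> q dvd k'"
      using multiplicity_decompose'[of "order G" q] g0 q(1) by (metis not_prime_unit)
    have "p \<noteq> q" using q g(2) by auto
    then have "coprime (p ^ b) (q ^ c)" using p q by (simp add: primes_coprime)
    moreover have "p ^ b dvd q ^ c * k'" using k g by (metis dvd_triv_left)
    \<comment> \<open>\<open>p ^ b\<close> is part of the complement of the \<open>q\<close>-part,
      so the bound for \<open>q\<close> limits \<open>p ^ b\<close> while the bound for
      \<open>p\<close> limits \<open>g'\<close>.\<close>
    ultimately have "p ^ b dvd k'" by (simp only: coprime_dvd_mult_right_iff)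
    then have "p ^ b \<le> k'" using k g0 by (intro dvd_imp_le) auto
    then have "p ^ b < component_order"
      using prime_complement_less_component_order[OF q(1) qG k] by simp
    moreover have "g' < component_order" by (rule prime_complement_less_component_order[OF p g])
    ultimately have "order G < component_order * component_order"
      using g(1) mult_strict_mono[of "p ^ b" component_order g' component_order] component_order_pos by simp
    then show False using m by simp
  qed
  then show thesis using that p g by simp
qed

end

subsection \<open>ES-partitions with normal intersection\<close>

context group begin

lemma ES_partition_factor_group:
  assumes fin: "finite (carrier G)" and S: "S \<lhd> G" and P: "ES_partition G S P"
  shows "ES_partition (G Mod S) {S} ((\<lambda>H. (\<lambda>x. S #> x) ` H) ` P)"
proof -
  interpret S: normal S G by fact
  interpret Q: group "G Mod S" by (rule S.factorgroup_is_group)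
  interpret h: group_hom G "G Mod S" "\<lambda>g. S #> g"
    by (intro group_hom.intro is_group Q.is_group group_hom_axioms.intro S.r_coset_hom_Mod)
  let ?f = "\<lambda>H. (\<lambda>x. S #> x) ` H"
  have part: "strict_partition G S P" and eq: "\<And>H K. \<lbrakk>H \<in> P; K \<in> P\<rbrakk> \<Longrightarrow> card H = card K"
    using P unfolding ES_partition_def by blast+
  then have sub: "\<And>H. H \<in> P \<Longrightarrow> subgroup H G" and ne: "\<And>H. H \<in> P \<Longrightarrow> H \<noteq> carrier G"
    and cover: "carrier G = \<Union> P" and disj: "\<And>H K. \<lbrakk>H \<in> P; K \<in> P; H \<noteq> K\<rbrakk> \<Longrightarrow> H \<inter> K = S"
    and finP: "finite P" and Sprop: "S \<noteq> carrier G"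
    unfolding strict_partition_def proper_subgroup_def by blast+
  \<comment> \<open>A single proper subgroup cannot cover the group, so every component has a
    partner with which it intersects in \<open>S\<close>.\<close>
  have SH: "S \<subseteq> H" if H: "H \<in> P" for H
  proof -
    have "\<exists>K \<in> P. K \<noteq> H"
    proof (rule ccontr)
      assume "\<not> (\<exists>K \<in> P. K \<noteq> H)"
      then have "P = {H}" using H by blast
      then show False using cover ne[OF H] by simp
    qed
    then show ?thesis using disj H by blast
  qed
  \<comment> \<open>Components are unions of cosets of \<open>S\<close>, so membership can be read
    off in the quotient; properness and intersections transfer through this.\<close>
  have mem: "x \<in> H" if H: "H \<in> P" and x: "x \<in> carrier G" "S #> x \<in> ?f H" for x H
  proof -
    obtain y where y: "y \<in> H" "S #> x = S #> y" using x by blast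
    then have "x \<in> S #> y" using rcos_self[OF x(1) S.is_subgroup] by simp
    then obtain s where "s \<in> S" "x = s \<otimes> y" by (auto simp: r_coset_def)
    then show ?thesis using SH[OF H] y subgroup.m_closed[OF sub[OF H]] by blast
  qed
  have one: "S \<in> ?f H" if H: "H \<in> P" for H
    using subgroup.one_closed[OF sub[OF H]] S.subset by (intro image_eqI[of _ _ \<one>]) auto
  have proper: "proper_subgroup (?f H) (G Mod S)" if H: "H \<in> P" for H
  proof -
    have "?f H \<noteq> carrier (G Mod S)"
    proof
      assume eqf: "?f H = carrier (G Mod S)"
      have "x \<in> H" if "x \<in> carrier G" for x
        using mem[OF H that] that unfolding eqf by (auto simp: carrier_FactGroup)
      then show False using ne[OF H] subgroup.subset[OF sub[OF H]] by blast
    qed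
    then show ?thesis
      using h.subgroup_img_is_subgroup[OF sub[OF H]] by (simp add: proper_subgroup_def)
  qed
  have card_f: "card (?f H) * card S = card H" if H: "H \<in> P" for H
  proof -
    interpret H: group "G\<lparr>carrier := H\<rparr>" by (rule subgroup_imp_group[OF sub[OF H]])
    have "rcosets\<^bsub>G\<lparr>carrier := H\<rparr>\<^esub> S = ?f H" by (auto simp: RCOSETS_def)
    then show ?thesis
      using H.lagrange[OF subgroup_incl[OF S.is_subgroup sub[OF H] SH[OF H]]] by (simp add: order_def)
  qed
  have S0: "card S \<noteq> 0" using subgroup.finite_imp_card_positive[OF S.is_subgroup fin] by simp
  show ?thesis
    unfolding ES_partition_def strict_partition_def
  proof (intro conjI ballI impI)
    have "{S} \<noteq> carrier (G Mod S)"
    proof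
      assume a: "{S} = carrier (G Mod S)"
      have "x \<in> S" if "x \<in> carrier G" for x
      proof -
        have "S #> x \<in> {S}" using that unfolding a by (auto simp: carrier_FactGroup)
        then show ?thesis using rcos_self[OF that S.is_subgroup] by simp
      qed
      then show False using Sprop S.subset by blast
    qed
    then show "proper_subgroup {S} (G Mod S)" using Q.triv_subgroup by (simp add: proper_subgroup_def)
    show "finite (?f ` P)" using finP by simp
    show "carrier (G Mod S) = \<Union> (?f ` P)"
      unfolding carrier_FactGroup cover by blast
    show "proper_subgroup H' (G Mod S)" if "H' \<in> ?f ` P" for H' using that proper by blast
    show "H' \<inter> K' = {S}" if HK: "H' \<in> ?f ` P" "K' \<in> ?f ` P" "H' \<noteq> K'" for H' K'
    proof -
      obtain H K where H: "H \<in> P" "H' = ?f H" and K: "K \<in> P" "K' = ?f K" using HK by blast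
      have int: "H \<inter> K = S" using disj H K HK(3) by blast
      have "u = S" if u: "u \<in> H' \<inter> K'" for u
      proof -
        obtain x where x: "x \<in> H" "u = S #> x" using u H by blast
        have xc: "x \<in> carrier G" using x subgroup.mem_carrier[OF sub[OF H(1)]] by blast
        then have "x \<in> S" using mem[OF K(1) xc] u x K int by blast
        then show ?thesis using x xc by (simp add: coset_join2 S.is_subgroup)
      qed
      then show ?thesis using one H K by blast
    qed
    show "card H' = card K'" if HK: "H' \<in> ?f ` P" "K' \<in> ?f ` P" for H' K'
    proof -
      obtain H K where H: "H \<in> P" "H' = ?f H" and K: "K \<in> P" "K' = ?f K" using HK by blast
      have "card H' * card S = card K' * card S"
        using card_f[OF H(1)] card_f[OF K(1)] eq[OF H(1) K(1)] H K by simp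
      then show ?thesis using S0 by simp
    qed
  qed
qed

lemma ES_partition_imp_nilpotent:
  assumes fin: "finite (carrier G)" and S: "S \<lhd> G" "S \<subseteq> upper_central G i"
    and P: "ES_partition G S P"
  shows "nilpotent_group G"
proof -
  interpret S: normal S G by fact
  have "equal_partition (G Mod S) ((\<lambda>H. (\<lambda>x. S #> x) ` H) ` P)"
    using ES_partition_factor_group[OF fin S(1) P] fin S.factorgroup_is_group
    by (intro equal_partition.intro equal_partition_axioms.intro) (simp_all add: carrier_FactGroup)
  then obtain p k where pk: "Factorial_Ring.prime (p::nat)" "order (G Mod S) = p ^ k"
    using equal_partition.order_prime_power by metis
  have "order G = p ^ k * card S"
    using lagrange[OF S.is_subgroup] pk(2) by (simp add: order_def FactGroup_def)
  then show ?thesis using prime_power_index_nilpotent[OF fin S.is_subgroup S(2) pk(1)] by blast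
qed

section \<open>Maximal subgroups and the construction of ES-partitions\<close>

definition maximal_subgroup :: "'a set \<Rightarrow> bool" where
  "maximal_subgroup M \<longleftrightarrow> proper_subgroup M G \<and>
     (\<forall>K. subgroup K G \<longrightarrow> M \<subseteq> K \<longrightarrow> K = M \<or> K = carrier G)"

lemma maximal_subgroup_exists:
  assumes fin: "finite (carrier G)" and H: "subgroup H G" "H \<noteq> carrier G"
  obtains M where "maximal_subgroup M" "H \<subseteq> M"
proof -
  let ?F = "{K. proper_subgroup K G \<and> H \<subseteq> K}"
  have "finite ?F"
    by (rule finite_subset[of _ "Pow (carrier G)"])
      (use fin subgroup.subset in \<open>auto simp: proper_subgroup_def\<close>)
  moreover have "H \<in> ?F" using H by (simp add: proper_subgroup_def)
  ultimately have "\<exists>M \<in> ?F. \<forall>K \<in> ?F. M \<subseteq> K \<longrightarrow> M = K"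
    by (intro finite_has_maximal) blast+
  then obtain M where M: "M \<in> ?F" "\<forall>K \<in> ?F. M \<subseteq> K \<longrightarrow> M = K" by blast
  then have "maximal_subgroup M"
    unfolding maximal_subgroup_def proper_subgroup_def by blast
  then show thesis using that M by blast
qed

lemma maximal_subgroup_normal:
  assumes fin: "finite (carrier G)" and nil: "nilpotent_group G" and M: "maximal_subgroup M"
  shows "M \<lhd> G"
proof (rule normal_if_normalizer_carrier[OF fin])
  have sub: "subgroup M G" "M \<noteq> carrier G"
    using M by (auto simp: maximal_subgroup_def proper_subgroup_def)
  then show "subgroup M G" by simp
  obtain x where x: "x \<in> carrier G - M" "\<And>h. h \<in> M \<Longrightarrow> x \<otimes> h \<otimes> inv x \<in> M"
    using nilpotent_normalizer_condition[OF nil sub] by metis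
  have "x \<in> normalizer G M"
    using x mem_normalizer_iff[OF fin subgroup.subset[OF sub(1)]] by blast
  then show "normalizer G M = carrier G"
    using M x subset_normalizer[OF fin sub(1)] normalizer_imp_subgroup[OF subgroup.subset[OF sub(1)]]
    unfolding maximal_subgroup_def by blast
qed

lemma ord_Mod_dvd:
  assumes "N \<lhd> G" "x \<in> carrier G" "x [^] (n::nat) \<in> N"
  shows "group.ord (G Mod N) (N #> x) dvd n"
proof -
  interpret N: normal N G by fact
  interpret Q: group "G Mod N" by (rule N.factorgroup_is_group)
  have "(N #> x) [^]\<^bsub>G Mod N\<^esub> n = \<one>\<^bsub>G Mod N\<^esub>"
    using assms by (simp add: N.FactGroup_pow coset_join2 N.is_subgroup)
  then show ?thesis using Q.pow_eq_id assms(2) by (auto simp: carrier_FactGroup)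
qed

lemma ord_Mod_eq_one:
  assumes "N \<lhd> G" "x \<in> carrier G" "group.ord (G Mod N) (N #> x) = 1"
  shows "x \<in> N"
proof -
  interpret N: normal N G by fact
  interpret Q: group "G Mod N" by (rule N.factorgroup_is_group)
  have "N #> x = N" using assms Q.ord_eq_1[of "N #> x"] by (auto simp: carrier_FactGroup)
  then show ?thesis using rcos_self[OF assms(2) N.is_subgroup] by simp
qed

text \<open>A suitable power of an element outside \<open>M\<close> has prime order \<open>p\<close>
  modulo \<open>M\<close>. By maximality it generates the group together with \<open>M\<close>, so
  the index is \<open>p\<close>.\<close>

lemma normal_maximal_subgroup_index:
  assumes fin: "finite (carrier G)" and M: "maximal_subgroup M" "M \<lhd> G"
  obtains p where "Factorial_Ring.prime (p::nat)" "order G = p * card M" "\<And>x. x \<in> carrier G \<Longrightarrow> x [^] p \<in> M"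
proof -
  interpret M: normal M G by fact
  interpret Q: group "G Mod M" by (rule M.factorgroup_is_group)
  have "M \<noteq> carrier G" using M by (auto simp: maximal_subgroup_def proper_subgroup_def)
  then obtain x where x: "x \<in> carrier G" "x \<notin> M" using M.subset by blast
  let ?r = "Q.ord (M #> x)"
  have xc: "M #> x \<in> carrier (G Mod M)" using x by (auto simp: carrier_FactGroup)
  have finQ: "finite (carrier (G Mod M))" using fin by (simp add: carrier_FactGroup)
  have "?r \<noteq> 1" using ord_Mod_eq_one[OF M(2) x(1)] x(2) by blast
  then obtain p where p: "Factorial_Ring.prime p" "p dvd ?r" using prime_factor_nat by blast
  have r0: "?r \<noteq> 0" using Q.ord_ge_1[OF finQ xc] by simp
  define k where "k = ?r div p"
  have k: "?r = k * p" using p(2) by (simp add: k_def)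
  let ?y = "x [^] k"
  have "Q.ord ((M #> x) [^]\<^bsub>G Mod M\<^esub> k) = ?r div k"
    using k r0 by (intro Q.ord_pow xc) auto
  then have oy: "Q.ord (M #> ?y) = p" using x k r0 by (simp add: M.FactGroup_pow)
  have yc: "?y \<in> carrier G" using x by simp
  note ext = cyclic_extension[OF fin M(2) yc]
  have "?y \<notin> M"
  proof
    assume "?y \<in> M"
    then have "p dvd 1" using ord_Mod_dvd[OF M(2) yc, of 1] oy yc by simp
    then show False using p(1) by auto
  qed
  then have "cyclic_extension M ?y = carrier G"
    using M(1) ext(1-3) unfolding maximal_subgroup_def by blast
  then have ord: "order G = p * card M" using ext(5) oy by (simp add: order_def)
  moreover have "card (rcosets M) = p"
    using lagrange[OF M.is_subgroup] ord subgroup.finite_imp_card_positive[OF M.is_subgroup fin] by simp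
  ultimately show thesis using that p(1) normal_pow_index[OF M(2)] by metis
qed

lemma same_index_maximal_subgroups:
  assumes fin: "finite (carrier G)" and nil: "nilpotent_group G" and cyc: "\<not> cyclic_group G"
  obtains M N where "maximal_subgroup M" "maximal_subgroup N" "M \<noteq> N" "card M = card N"
proof (rule ccontr)
  assume contr: "\<not> thesis"
  note thesisI = that
  have inj: "M = N" if "maximal_subgroup M" "maximal_subgroup N" "card M = card N" for M N
    using that contr thesisI by blast
  let ?A = "\<lambda>x. {M. maximal_subgroup M \<and> x \<notin> M}"
  have finA: "finite (?A x)" for x
    by (rule finite_subset[of _ "Pow (carrier G)"])
      (use fin subgroup.subset in \<open>auto simp: maximal_subgroup_def proper_subgroup_def\<close>)
  define num where "num z = card (?A z)" for z
  have "Max (num ` carrier G) \<in> num ` carrier G" using fin one_closed by (intro Max_in) auto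
  then obtain x where x: "x \<in> carrier G" "Max (num ` carrier G) = num x" by blast
  have max: "num z \<le> num x" if "z \<in> carrier G" for z
    using that fin x(2) Max_ge[of "num ` carrier G" "num z"] by simp
  have "x \<notin> M" if M: "maximal_subgroup M" for M
  proof
    assume xM: "x \<in> M"
    have subM: "subgroup M G" "M \<noteq> carrier G"
      using M by (auto simp: maximal_subgroup_def proper_subgroup_def)
    obtain p where p: "Factorial_Ring.prime p" "order G = p * card M" "\<And>x. x \<in> carrier G \<Longrightarrow> x [^] p \<in> M"
      using normal_maximal_subgroup_index[OF fin M maximal_subgroup_normal[OF fin nil M]] by metis
    obtain y where y: "y \<in> carrier G" "y \<notin> M" using subM subgroup.subset by blast
    have g0: "order G \<noteq> 0" using fin order_gt_0_iff_finite by auto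
    then obtain b m where m: "order G = p ^ b * m" "\<not> p dvd m"
      using multiplicity_decompose'[of "order G" p] p(1) by (metis not_prime_unit)
    have cop: "coprime p m" using m p(1) by (simp add: prime_imp_coprime)
    have ymM: "y [^] m \<notin> M"
      using subgroup_coprime_powers_mem[OF subM(1) y(1) p(3)[OF y(1)] _ cop] y(2) by blast
    \<comment> \<open>Here \<open>m\<close> is the part of the group order prime to
      \<open>p\<close>. The power \<open>y [^] m\<close> is outside \<open>M\<close>, but lies in
      every maximal subgroup of another index, since that index divides \<open>m\<close>. By the
      assumed uniqueness \<open>M\<close> is the only one of index \<open>p\<close>, so the product
      avoids \<open>M\<close> and everything that \<open>x\<close> avoided.\<close>
    let ?z = "x \<otimes> y [^] m"
    have zc: "?z \<in> carrier G" using x y by simp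
    have zM: "?z \<notin> M"
    proof
      assume "?z \<in> M"
      then have "inv x \<otimes> ?z \<in> M" using xM subM(1) subgroup.m_closed subgroup.m_inv_closed by metis
      then show False using ymM x y by simp
    qed
    have "?z \<notin> K" if K: "maximal_subgroup K" "x \<notin> K" for K
    proof
      assume zK: "?z \<in> K"
      have subK: "subgroup K G" using K by (auto simp: maximal_subgroup_def proper_subgroup_def)
      obtain q where q: "Factorial_Ring.prime q" "order G = q * card K" "\<And>x. x \<in> carrier G \<Longrightarrow> x [^] q \<in> K"
        using normal_maximal_subgroup_index[OF fin K(1) maximal_subgroup_normal[OF fin nil K(1)]] by metis
      have "q \<noteq> p"
      proof
        assume "q = p"
        then have "card K = card M" using q p prime_gt_0_nat[OF p(1)] by simp
        then show False using inj[OF K(1) M] K(2) xM by blast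
      qed
      then have "coprime q (p ^ b)" using p q by (simp add: primes_coprime)
      moreover have "q dvd p ^ b * m" using q m by (metis dvd_triv_left)
      ultimately have "q dvd m" by (simp only: coprime_dvd_mult_right_iff)
      then obtain l where l: "m = q * l" by blast
      have "y [^] m = (y [^] l) [^] q" using y l by (simp add: nat_pow_pow mult.commute)
      then have "y [^] m \<in> K" using q(3)[of "y [^] l"] y by simp
      then have "?z \<otimes> inv (y [^] m) \<in> K"
        using zK subK subgroup.m_closed subgroup.m_inv_closed by metis
      then show False using K x y by (simp add: m_assoc)
    qed
    then have "?A x \<subset> ?A ?z" using M xM zM by blast
    then have "card (?A x) < card (?A ?z)" using finA psubset_card_mono by blast
    then show False using max[OF zc] by (simp add: num_def)
  qed
  moreover have gs: "subgroup (generate G {x}) G" using x by (intro generate_is_subgroup) auto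
  moreover have "x \<in> generate G {x}" by (simp add: generate.incl)
  ultimately have "generate G {x} = carrier G"
    using maximal_subgroup_exists[OF fin gs] by blast
  then have "subgroup_generated G {x} = G" using x by (simp add: subgroup_generated_def)
  then show False using cyc x by (auto simp: cyclic_group_def)
qed

lemma nilpotent_ES_partition:
  assumes fin: "finite (carrier G)" and nil: "nilpotent_group G" and cyc: "\<not> cyclic_group G"
  obtains S P where "ES_partition G S P" "S \<lhd> G"
proof -
  obtain M K where MK: "maximal_subgroup M" "maximal_subgroup K" "M \<noteq> K" "card M = card K"
    using same_index_maximal_subgroups[OF fin nil cyc] .
  have normM: "M \<lhd> G" and normK: "K \<lhd> G" using maximal_subgroup_normal[OF fin nil] MK by auto
  have subM: "subgroup M G" and subK: "subgroup K G" using normM normK by (simp_all add: normal_imp_subgroup)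
  obtain p where p: "Factorial_Ring.prime p" "order G = p * card M" "\<And>x. x \<in> carrier G \<Longrightarrow> x [^] p \<in> M"
    using normal_maximal_subgroup_index[OF fin MK(1) normM] by metis
  obtain q where q: "Factorial_Ring.prime q" "order G = q * card K" "\<And>x. x \<in> carrier G \<Longrightarrow> x [^] q \<in> K"
    using normal_maximal_subgroup_index[OF fin MK(2) normK] by metis
  have M0: "card M > 0" by (rule subgroup.finite_imp_card_positive[OF subM fin])
  then have qp: "q = p" using p(2) q(2) MK(4) by simp
  let ?N = "M \<inter> K"
  have N: "?N \<lhd> G" by (rule normal_subgroup_intersect[OF normM normK])
  have subN: "subgroup ?N G" by (rule normal_imp_subgroup[OF N])
  have finM: "finite M" by (rule finite_subset[OF subgroup.subset[OF subM] fin])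
  have "M \<noteq> ?N"
    using MK(1-3) subM subK by (metis Int_lower2 maximal_subgroup_def proper_subgroup_def)
  then have NM: "card ?N < card M" by (intro psubset_card_mono finM) blast
  have N0: "card ?N > 0" by (rule subgroup.finite_imp_card_positive[OF subN fin])
  let ?P = "cyclic_extension ?N ` (carrier G - ?N)"
  \<comment> \<open>The \<open>p\<close>-th power of any element lies in \<open>M\<close> and in
    \<open>K\<close>, so an element outside \<open>?N\<close> has order exactly \<open>p\<close>
    modulo \<open>?N\<close>.\<close>
  have card_ext: "card H = p * card ?N" and sub_ext: "subgroup H G" and N_ext: "?N \<subseteq> H" if H: "H \<in> ?P" for H
  proof -
    obtain x where x: "x \<in> carrier G" "x \<notin> ?N" "H = cyclic_extension ?N x" using H by blast
    note ext = cyclic_extension[OF fin N x(1)]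
    show "subgroup H G" "?N \<subseteq> H" using ext x by auto
    have "x [^] p \<in> ?N" using x p(3) q(3) qp by simp
    then have "group.ord (G Mod ?N) (?N #> x) dvd p" by (rule ord_Mod_dvd[OF N x(1)])
    moreover have "group.ord (G Mod ?N) (?N #> x) \<noteq> 1" using ord_Mod_eq_one[OF N x(1)] x(2) by blast
    ultimately have "group.ord (G Mod ?N) (?N #> x) = p" using p(1) prime_nat_iff by blast
    then show "card H = p * card ?N" using ext(5) x(3) by simp
  qed
  \<comment> \<open>Having two distinct maximal subgroups matters here: it makes \<open>?N\<close>
    smaller than \<open>M\<close>, whose index is \<open>p\<close>, so the extensions are
    proper.\<close>
  have lt: "p * card ?N < order G" using p NM prime_gt_0_nat[OF p(1)] by simp
  have Nne: "carrier G - ?N \<noteq> {}"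
    using NM p(2) prime_gt_0_nat[OF p(1)] subgroup.subset[OF subM] \<open>M \<noteq> ?N\<close> by blast
  have "ES_partition G ?N ?P"
    unfolding ES_partition_def strict_partition_def
  proof (intro conjI ballI impI)
    show "proper_subgroup ?N G" using subN Nne by (auto simp: proper_subgroup_def)
    show "finite ?P" using fin by simp
    show "proper_subgroup H G" if "H \<in> ?P" for H
      using sub_ext[OF that] card_ext[OF that] lt by (auto simp: proper_subgroup_def order_def)
    show "carrier G = \<Union> ?P"
    proof
      show "carrier G \<subseteq> \<Union> ?P"
      proof
        fix x assume x: "x \<in> carrier G"
        obtain y where y: "y \<in> carrier G - ?N" using Nne by blast
        show "x \<in> \<Union> ?P"
        proof (cases "x \<in> ?N")
          case True
          then show ?thesis using N_ext[of "cyclic_extension ?N y"] y by blast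
        next
          case False
          then show ?thesis using cyclic_extension(3)[OF fin N x] x by blast
        qed
      qed
      show "\<Union> ?P \<subseteq> carrier G" using sub_ext subgroup.subset by blast
    qed
    \<comment> \<open>The intersection lies between \<open>?N\<close> and a group of order
      \<open>p\<close> times \<open>card ?N\<close>, so it is \<open>?N\<close> or equal to both
      components.\<close>
    show "H \<inter> L = ?N" if HL: "H \<in> ?P" "L \<in> ?P" "H \<noteq> L" for H L
    proof -
      have sub: "subgroup (H \<inter> L) G" by (rule subgroups_Inter_pair[OF sub_ext sub_ext]) fact+
      have fH: "finite H" "finite L" using finite_subset[OF subgroup.subset[OF sub_ext] fin] HL by blast+
      have NI: "?N \<subseteq> H \<inter> L" using N_ext HL by blast
      obtain c where c: "card (H \<inter> L) = card ?N * c"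
        using card_subgroup_dvd_subgroup[OF subN sub NI] by blast
      have "card (H \<inter> L) dvd p * card ?N"
        using card_subgroup_dvd_subgroup[OF sub sub_ext[OF HL(1)]] card_ext[OF HL(1)] by simp
      then have "c dvd p" using c N0 by simp
      moreover have "c \<noteq> p"
      proof
        assume "c = p"
        then have cards: "card (H \<inter> L) = card H" "card (H \<inter> L) = card L" using c card_ext HL by simp_all
        have "H \<inter> L = H" by (rule card_subset_eq[OF fH(1) Int_lower1 cards(1)])
        moreover have "H \<inter> L = L" by (rule card_subset_eq[OF fH(2) Int_lower2 cards(2)])
        ultimately have "H = L" by simp
        then show False using HL by blast
      qed
      ultimately have "c = 1" using p(1) prime_nat_iff by blast
      then show ?thesis using c card_subset_eq[OF _ NI] fH by simp
    qed
    show "card H = card L" if "H \<in> ?P" "L \<in> ?P" for H L using card_ext that by simp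
  qed
  then show thesis using that N by blast
qed

end

subsection \<open>Conjugates of maximal subgroups\<close>

context group begin

definition conjugates :: "'a set \<Rightarrow> 'a set set" where
  "conjugates K = (\<lambda>g. g <# K #> inv g) ` carrier G"

lemma mem_conjugate_iff:
  assumes "K \<subseteq> carrier G" "g \<in> carrier G" "x \<in> carrier G"
  shows "x \<in> g <# K #> inv g \<longleftrightarrow> inv g \<otimes> x \<otimes> g \<in> K"
proof
  assume "x \<in> g <# K #> inv g"
  then obtain k where "k \<in> K" "x = g \<otimes> k \<otimes> inv g" by (auto simp: l_coset_def r_coset_def)
  then show "inv g \<otimes> x \<otimes> g \<in> K" using assms by (simp add: m_assoc subset_iff)
next
  assume a: "inv g \<otimes> x \<otimes> g \<in> K"
  have "x = g \<otimes> (inv g \<otimes> x \<otimes> g) \<otimes> inv g" using assms by (simp add: m_assoc)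
  then show "x \<in> g <# K #> inv g" using a by (auto simp: l_coset_def r_coset_def)
qed

lemma card_conjugates:
  assumes "K \<subseteq> carrier G"
  shows "card (conjugates K) * card (normalizer G K) = order G"
proof -
  let ?\<phi> = "\<lambda>g. \<lambda>H \<in> {H. H \<subseteq> carrier G}. g <# H #> inv g"
  interpret act: group_action G "{H. H \<subseteq> carrier G}" ?\<phi> by (rule action_by_conjugation_on_power_set)
  have "orbit G ?\<phi> K = conjugates K" using assms by (auto simp: orbit_def conjugates_def)
  then show ?thesis using act.orbit_stabilizer_theorem[of K] assms by (simp add: normalizer_def)
qed

lemma conjugates_cong:
  assumes "K \<subseteq> carrier G" "C \<in> conjugates K"
  shows "K \<in> conjugates C"
proof -
  obtain g where g: "g \<in> carrier G" "C = g <# K #> inv g" using assms by (auto simp: conjugates_def)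
  have "inv g <# C #> inv (inv g) = K"
    using subgroup_conjugation_is_surj0[of "inv g" K] g assms(1) by simp
  then have "K = inv g <# C #> inv (inv g)" by simp
  then show ?thesis using g unfolding conjugates_def by blast
qed

lemma self_mem_conjugates: "K \<subseteq> carrier G \<Longrightarrow> K \<in> conjugates K"
  unfolding conjugates_def by (intro image_eqI[of _ _ \<one>]) (auto simp: lcos_mult_one)

text \<open>If there are o conjugates, then o times \<open>card C\<close> is at most the group
  order, and as all share the identity they contain at most \<open>order G - o\<close> non-identity
  elements. Covering therefore forces o = 1.\<close>

lemma conjugates_not_cover:
  assumes fin: "finite (carrier G)" and C: "subgroup C G" and cover: "carrier G \<subseteq> \<Union> (conjugates C)"
  shows "C = carrier G"
proof -
  have CG: "C \<subseteq> carrier G" by (rule subgroup.subset[OF C])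
  have finC: "finite (conjugates C)" using fin by (simp add: conjugates_def)
  have conj: "subgroup D G" "card D = card C" if "D \<in> conjugates C" for D
    using that conjugate_subgroup[OF C] by (auto simp: conjugates_def)
  let ?o = "card (conjugates C)"
  have pos: "card C > 0" by (rule subgroup.finite_imp_card_positive[OF C fin])
  have "card (carrier G - {\<one>}) \<le> card (\<Union>D\<in>conjugates C. D - {\<one>})"
  proof (rule card_mono)
    show "finite (\<Union>D\<in>conjugates C. D - {\<one>})"
      using finC finite_subset[OF subgroup.subset[OF conj(1)] fin] by blast
    show "carrier G - {\<one>} \<subseteq> (\<Union>D\<in>conjugates C. D - {\<one>})" using cover by blast
  qed
  also have "\<dots> \<le> (\<Sum>D\<in>conjugates C. card (D - {\<one>}))" by (rule card_UN_le[OF finC])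
  also have "\<dots> = (\<Sum>D\<in>conjugates C. card C - 1)"
  proof (rule sum.cong[OF refl])
    fix D assume D: "D \<in> conjugates C"
    have "finite D" using finite_subset[OF subgroup.subset[OF conj(1)[OF D]] fin] .
    then show "card (D - {\<one>}) = card C - 1"
      using conj(2)[OF D] subgroup.one_closed[OF conj(1)[OF D]] by simp
  qed
  finally have 1: "order G - 1 \<le> ?o * (card C - 1)" using fin by (simp add: order_def)
  have nC: "subgroup (normalizer G C) G" by (rule normalizer_imp_subgroup[OF CG])
  have "card C \<le> card (normalizer G C)"
    using finite_subset[OF subgroup.subset[OF nC] fin] subset_normalizer[OF fin C] by (rule card_mono)
  then have "?o * card C \<le> order G" using card_conjugates[OF CG] mult_le_mono2 by metis
  moreover have "?o * (card C - 1) = ?o * card C - ?o" by (simp add: diff_mult_distrib2)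
  moreover have "?o \<le> ?o * card C" using pos by simp
  moreover have "order G > 0" using fin order_gt_0_iff_finite by blast
  ultimately have "?o \<le> 1" using 1 by linarith
  moreover have "C \<in> conjugates C" by (rule self_mem_conjugates[OF CG])
  ultimately have "conjugates C = {C}"
    using finC card_le_Suc0_iff_eq[of "conjugates C"] by auto
  then show ?thesis using cover CG by auto
qed

lemma card_conjugates_union:
  assumes fin: "finite (carrier G)" and K: "subgroup K G" and NK: "N \<subseteq> K"
    and norm: "normalizer G K = K"
    and sub: "\<And>C. C \<in> conjugates K \<Longrightarrow> N \<subseteq> C"
    and int: "\<And>C D. \<lbrakk>C \<in> conjugates K; D \<in> conjugates K; C \<noteq> D\<rbrakk> \<Longrightarrow> C \<inter> D \<subseteq> N"
  shows "card (\<Union>C\<in>conjugates K. C - N) = card (conjugates K) * (card K - card N)"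
    and "card (conjugates K) * card K = order G"
proof -
  have KG: "K \<subseteq> carrier G" by (rule subgroup.subset[OF K])
  show "card (conjugates K) * card K = order G" using card_conjugates[OF KG] norm by simp
  have finC: "finite (conjugates K)" using fin by (simp add: conjugates_def)
  have conj: "subgroup D G" "card D = card K" if "D \<in> conjugates K" for D
    using that conjugate_subgroup[OF K] by (auto simp: conjugates_def)
  have finD: "finite D" if "D \<in> conjugates K" for D
    using finite_subset[OF subgroup.subset[OF conj(1)[OF that]] fin] .
  have finN: "finite N" by (rule finite_subset[OF NK finite_subset[OF KG fin]])
  have "card (\<Union>C\<in>conjugates K. C - N) = (\<Sum>C\<in>conjugates K. card (C - N))"
  proof (rule card_UN_disjoint[OF finC])
    show "\<forall>C\<in>conjugates K. finite (C - N)" using finD by simp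
    show "\<forall>C\<in>conjugates K. \<forall>D\<in>conjugates K. C \<noteq> D \<longrightarrow> (C - N) \<inter> (D - N) = {}" using int by blast
  qed
  also have "\<dots> = (\<Sum>C\<in>conjugates K. card K - card N)"
    using conj(2) sub finN by (intro sum.cong) (simp_all add: card_Diff_subset)
  finally show "card (\<Union>C\<in>conjugates K. C - N) = card (conjugates K) * (card K - card N)" by simp
qed

lemma maximal_conjugate:
  assumes fin: "finite (carrier G)" and M: "maximal_subgroup M" and g: "g \<in> carrier G"
  shows "maximal_subgroup (g <# M #> inv g)"
proof -
  have sub: "subgroup M G" "M \<noteq> carrier G" using M by (auto simp: maximal_subgroup_def proper_subgroup_def)
  have MG: "M \<subseteq> carrier G" by (rule subgroup.subset[OF sub(1)])
  let ?C = "g <# M #> inv g"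
  have subC: "subgroup ?C G" "card ?C = card M" by (rule conjugate_subgroup[OF sub(1) g])+
  have "K = ?C \<or> K = carrier G" if K: "subgroup K G" "?C \<subseteq> K" for K
  proof -
    have KG: "K \<subseteq> carrier G" by (rule subgroup.subset[OF K(1)])
    have finK: "finite K" by (rule finite_subset[OF KG fin])
    let ?L = "inv g <# K #> inv (inv g)"
    have L: "subgroup ?L G" "card ?L = card K" by (rule conjugate_subgroup[OF K(1) inv_closed[OF g]])+
    have "M \<subseteq> ?L"
    proof
      fix x assume x: "x \<in> M"
      then have xc: "x \<in> carrier G" using MG by blast
      have "g \<otimes> x \<otimes> inv g \<in> ?C" using x by (auto simp: l_coset_def r_coset_def)
      then show "x \<in> ?L" using K(2) mem_conjugate_iff[OF KG, of "inv g" x] g xc by auto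
    qed
    then consider "?L = M" | "?L = carrier G" using M L(1) unfolding maximal_subgroup_def by blast
    then show ?thesis
    proof cases
      case 1
      then have "card ?C = card K" using L subC by simp
      then show ?thesis using card_subset_eq[OF finK K(2)] by simp
    next
      case 2
      then have "card K = card (carrier G)" using L by simp
      then show ?thesis using card_subset_eq[OF fin KG] by simp
    qed
  qed
  moreover have "?C \<noteq> carrier G"
  proof
    assume "?C = carrier G"
    then have "card M = card (carrier G)" using subC(2) by simp
    then show False using sub(2) card_subset_eq[OF fin MG] by simp
  qed
  ultimately show ?thesis using subC(1) by (simp add: maximal_subgroup_def proper_subgroup_def)
qed

lemma maximal_not_normal_normalizer:
  assumes fin: "finite (carrier G)" and M: "maximal_subgroup M" "\<not> M \<lhd> G"
  shows "normalizer G M = M"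
proof -
  have sub: "subgroup M G" using M by (auto simp: maximal_subgroup_def proper_subgroup_def)
  have "normalizer G M = M \<or> normalizer G M = carrier G"
    using M(1) normalizer_imp_subgroup[OF subgroup.subset[OF sub]] subset_normalizer[OF fin sub]
    unfolding maximal_subgroup_def by blast
  then show ?thesis using normal_if_normalizer_carrier[OF fin sub] M(2) by blast
qed

text \<open>The counting step of Schmidt's theorem: modulo a maximal proper normal subgroup \<open>N\<close>, distinct
  maximal subgroups have trivial intersection, so the conjugates of a non-normal one cover at
  least half as many elements of \<open>G - N\<close> as \<open>G\<close> has, but not all of \<open>G - N\<close>; there is
  no room for the second conjugacy class needed to cover the rest.\<close>

lemma proper_nilpotent_imp_normal_maximal:
  assumes fin: "finite (carrier G)" and nontriv: "carrier G \<noteq> {\<one>}"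
    and nil: "\<And>H. \<lbrakk>subgroup H G; H \<noteq> carrier G\<rbrakk> \<Longrightarrow> nilpotent_group (G\<lparr>carrier := H\<rparr>)"
  obtains N where "maximal_subgroup N" "N \<lhd> G"
proof (rule ccontr)
  assume contr: "\<not> thesis"
  note thesisI = that
  have no: "\<not> K \<lhd> G" if "maximal_subgroup K" for K using that contr thesisI by blast
  let ?F = "{N. N \<lhd> G \<and> N \<noteq> carrier G}"
  have "finite ?F"
    by (rule finite_subset[of _ "Pow (carrier G)"])
      (use fin subgroup.subset[OF normal_imp_subgroup] in \<open>blast, simp\<close>)
  moreover have "{\<one>} \<in> ?F" using nontriv one_is_normal by auto
  ultimately have "\<exists>N \<in> ?F. \<forall>K \<in> ?F. N \<subseteq> K \<longrightarrow> N = K"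
    by (intro finite_has_maximal) blast+
  then obtain N where N: "N \<lhd> G" "N \<noteq> carrier G" "\<And>K. \<lbrakk>K \<lhd> G; K \<noteq> carrier G; N \<subseteq> K\<rbrakk> \<Longrightarrow> N = K"
    by blast
  have subN: "subgroup N G" by (rule normal_imp_subgroup[OF N(1)])
  have finN: "finite N" by (rule finite_subset[OF subgroup.subset[OF subN] fin])
  have N0: "card N > 0" by (rule subgroup.finite_imp_card_positive[OF subN fin])
  have maxD: "subgroup K G" "K \<noteq> carrier G" "K \<subseteq> carrier G" if "maximal_subgroup K" for K
    using that subgroup.subset[of K G] by (simp_all add: maximal_subgroup_def proper_subgroup_def)
  have max_eq: "A = B" if "maximal_subgroup A" "maximal_subgroup B" "A \<subseteq> B" for A B
    using that(1,3) maxD(1,2)[OF that(2)] unfolding maximal_subgroup_def by blast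
  \<comment> \<open>Maximal subgroups are nilpotent by assumption, so normalizers grow inside
    them.\<close>
  have grow: "\<exists>x. x \<in> A - D \<and> x \<in> normalizer G D"
    if A: "maximal_subgroup A" and D: "subgroup D G" "D \<subseteq> A" "D \<noteq> A" for A D
  proof -
    interpret A: group "G\<lparr>carrier := A\<rparr>" by (rule subgroup_imp_group[OF maxD(1)[OF A]])
    have "subgroup D (G\<lparr>carrier := A\<rparr>)" by (rule subgroup_incl[OF D(1) maxD(1)[OF A] D(2)])
    then obtain x where x: "x \<in> A - D" "\<And>h. h \<in> D \<Longrightarrow> x \<otimes>\<^bsub>G\<lparr>carrier := A\<rparr>\<^esub> h \<otimes>\<^bsub>G\<lparr>carrier := A\<rparr>\<^esub> inv\<^bsub>G\<lparr>carrier := A\<rparr>\<^esub> x \<in> D"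
      using A.nilpotent_normalizer_condition[OF nil[OF maxD(1,2)[OF A]], of D] D(3) by auto
    then have "x \<in> normalizer G D"
      using subgroup.subset[OF maxD(1)[OF A]] maxD(1)[OF A]
      by (subst mem_normalizer_iff[OF fin subgroup.subset[OF D(1)]]) auto
    then show ?thesis using x(1) by blast
  qed
  \<comment> \<open>Induction from large intersections to small ones. If the intersection is normal,
    it equals \<open>N\<close> by the choice of \<open>N\<close>; otherwise its normalizer lies in
    some maximal \<open>L\<close>, which meets both \<open>A\<close> and \<open>B\<close> in
    something larger, so by induction \<open>A\<close> and \<open>B\<close> both equal
    \<open>L\<close>.\<close>
  have int: "A \<inter> B = N"
    if "maximal_subgroup A" "maximal_subgroup B" "A \<noteq> B" "N \<subseteq> A" "N \<subseteq> B" for A B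
    using that
  proof (induction "order G - card (A \<inter> B)" arbitrary: A B rule: less_induct)
    case less
    let ?D = "A \<inter> B"
    have subD: "subgroup ?D G" by (intro subgroups_Inter_pair maxD(1) less.prems)
    have DA: "?D \<noteq> A" using less.prems(3) max_eq[OF less.prems(1,2)] by blast
    have DB: "?D \<noteq> B" using less.prems(3) max_eq[OF less.prems(2,1)] by blast
    have bigger: "A' = L" if A': "maximal_subgroup A'" "N \<subseteq> A'" "?D \<subseteq> A'" "?D \<noteq> A'"
      and L: "maximal_subgroup L" "normalizer G ?D \<subseteq> L" for A' L
    proof (rule ccontr)
      assume "A' \<noteq> L"
      obtain x where x: "x \<in> A' - ?D" "x \<in> normalizer G ?D" using grow[OF A'(1) subD A'(3,4)] by blast
      have DL: "?D \<subseteq> L" using subset_normalizer[OF fin subD] L(2) by blast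
      have ps: "?D \<subset> A' \<inter> L" using x L(2) A'(3) DL by blast
      have "card ?D < card (A' \<inter> L)"
        using ps finite_subset[OF subgroup.subset[OF maxD(1)[OF A'(1)]] fin] by (intro psubset_card_mono) auto
      moreover have "card (A' \<inter> L) \<le> order G"
        unfolding order_def using subgroup.subset[OF maxD(1)[OF A'(1)]] by (intro card_mono fin) blast
      ultimately have "A' \<inter> L = N"
        using less.prems A' L DL \<open>A' \<noteq> L\<close> by (intro less.hyps) auto
      then show False using ps less.prems by blast
    qed
    have "?D \<lhd> G"
    proof (rule ccontr)
      assume "\<not> ?D \<lhd> G"
      then have "normalizer G ?D \<noteq> carrier G" using normal_if_normalizer_carrier[OF fin subD] by blast
      then obtain L where L: "maximal_subgroup L" "normalizer G ?D \<subseteq> L"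
        using maximal_subgroup_exists[OF fin normalizer_imp_subgroup[OF subgroup.subset[OF subD]]] by blast
      have "A = L" using less.prems DA by (intro bigger L) auto
      moreover have "B = L" using less.prems DB by (intro bigger L) auto
      ultimately show False using less.prems by simp
    qed
    moreover have "?D \<noteq> carrier G" using maxD[OF less.prems(1)] by blast
    ultimately show "?D = N" using N(3) less.prems by blast
  qed
  have conjN: "N \<subseteq> C" "maximal_subgroup C" if C: "C \<in> conjugates K" and K: "maximal_subgroup K" "N \<subseteq> K" for C K
  proof -
    obtain g where g: "g \<in> carrier G" "C = g <# K #> inv g" using C by (auto simp: conjugates_def)
    then show "maximal_subgroup C" using maximal_conjugate[OF fin K(1)] by simp
    interpret N: normal N G by fact
    show "N \<subseteq> C"
      using mem_conjugate_iff[OF subgroup.subset[OF maxD(1)[OF K(1)]] g(1)] N.inv_op_closed1[OF g(1)] K(2) g(2)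
        N.subset by blast
  qed
  have half: "order G \<le> 2 * card (\<Union>C\<in>conjugates K. C - N)"
    "card (\<Union>C\<in>conjugates K. C - N) < order G - card N" if K: "maximal_subgroup K" "N \<subseteq> K" for K
  proof -
    have subK: "subgroup K G" using maxD(1)[OF K(1)] .
    have finK: "finite K" by (rule finite_subset[OF subgroup.subset[OF subK] fin])
    have nK: "normalizer G K = K" by (rule maximal_not_normal_normalizer[OF fin K(1) no[OF K(1)]])
    have 1: "card (\<Union>C\<in>conjugates K. C - N) = card (conjugates K) * (card K - card N)"
      and 2: "card (conjugates K) * card K = order G"
      using card_conjugates_union[OF fin subK K(2) nK] conjN[OF _ K] int by (blast+)
    have "N \<noteq> K" using no[OF K(1)] N(1) by blast
    obtain c where c: "card K = card N * c" using card_subgroup_dvd_subgroup[OF subN subK K(2)] by blast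
    have "card N < card K" using \<open>N \<noteq> K\<close> K(2) by (intro psubset_card_mono finK) blast
    then have "c \<noteq> 0" "c \<noteq> 1" using c by auto
    then have "2 \<le> c" by simp
    \<comment> \<open>\<open>K\<close> properly contains \<open>N\<close>, so its order is at least
      twice that of \<open>N\<close>: removing \<open>N\<close> costs each conjugate at most half of
      its elements.\<close>
    then have 3: "2 * card N \<le> card K" using c by simp
    have "card (conjugates K) * (2 * card N) \<le> order G" using mult_le_mono2[OF 3, of "card (conjugates K)"] 2 by simp
    then show "order G \<le> 2 * card (\<Union>C\<in>conjugates K. C - N)"
      unfolding 1 using 2 by (simp add: diff_mult_distrib2)
    have "card K < order G"
      unfolding order_def using maxD[OF K(1)] by (intro psubset_card_mono fin) blast
    then have "card (conjugates K) \<noteq> 1" using 2 by auto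
    moreover have "card (conjugates K) \<noteq> 0"
    proof
      assume "card (conjugates K) = 0"
      then have "order G = 0" using 2 by simp
      then show False using \<open>card K < order G\<close> by simp
    qed
    \<comment> \<open>\<open>N\<close> is removed once from each of at least two conjugates, which
      gives the strict upper bound.\<close>
    ultimately have "2 \<le> card (conjugates K)" by simp
    then have "2 * card N \<le> card (conjugates K) * card N" by simp
    moreover have "card (conjugates K) * card N \<le> order G"
      using mult_le_mono2[OF less_imp_le[OF \<open>card N < card K\<close>], of "card (conjugates K)"] 2 by simp
    ultimately show "card (\<Union>C\<in>conjugates K. C - N) < order G - card N"
      unfolding 1 diff_mult_distrib2 2 using N0 by linarith
  qed
  obtain M where M: "maximal_subgroup M" "N \<subseteq> M"
    using maximal_subgroup_exists[OF fin subN N(2)] by blast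
  have subM: "subgroup M G" using maxD(1)[OF M(1)] .
  let ?U = "\<lambda>K. \<Union>C\<in>conjugates K. C - N"
  have UG: "?U K \<subseteq> carrier G - N" if "maximal_subgroup K" "N \<subseteq> K" for K
    using maxD(3)[OF conjN(2)[OF _ that]] by blast
  have cGN: "card (carrier G - N) = order G - card N"
    using subgroup.subset[OF subN] finN by (simp add: card_Diff_subset order_def)
  have "?U M \<noteq> carrier G - N" using half(2)[OF M] cGN by auto
  then obtain x where x: "x \<in> carrier G" "x \<notin> N" "x \<notin> ?U M" using UG[OF M] by blast
  note ext = cyclic_extension[OF fin N(1) x(1)]
  \<comment> \<open>If \<open>N\<close> and \<open>x\<close> generated the group, all commutators
    with \<open>x\<close> would lie in \<open>N\<close>, so \<open>x\<close> would normalize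
    \<open>M\<close>. But \<open>M\<close> is its own normalizer, and \<open>x\<close> avoids all
    conjugates of \<open>M\<close>.\<close>
  have "cyclic_extension N x \<noteq> carrier G"
  proof
    assume all: "cyclic_extension N x = carrier G"
    interpret N: normal N G by (rule N(1))
    have cz: "centralizer_mod N x = carrier G"
    proof
      have "carrier G \<subseteq> centralizer_mod N x"
      proof (rule order_trans[OF eq_refl[OF all[symmetric]] ext(4)[OF centralizer_mod_subgroup[OF N(1) x(1)]]])
        show "N \<subseteq> centralizer_mod N x"
        proof
          fix n assume n: "n \<in> N"
          then have "x \<otimes> n \<otimes> inv x \<otimes> inv n \<in> N"
            by (intro N.m_closed N.m_inv_closed N.inv_op_closed2 x(1))
          then show "n \<in> centralizer_mod N x"
            using n by (simp add: centralizer_mod_def commutator_def)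
        qed
        show "x \<in> centralizer_mod N x"
          using x(1) commutator_eq_one_iff[of x x] by (simp add: centralizer_mod_def)
      qed
      then show "carrier G \<subseteq> centralizer_mod N x" .
    qed (auto simp: centralizer_mod_def)
    have "x \<otimes> m \<otimes> inv x \<in> M" if m: "m \<in> M" for m
    proof -
      have mc: "m \<in> carrier G" using m subgroup.subset[OF subM] by blast
      have "commutator x m \<in> M" using cz mc M(2) by (auto simp: centralizer_mod_def)
      then have "commutator x m \<otimes> m \<in> M" using m subgroup.m_closed[OF subM] by blast
      then show ?thesis using x(1) mc by (simp add: commutator_def m_assoc)
    qed
    then have "x \<in> normalizer G M" using x(1) by (simp add: mem_normalizer_iff[OF fin subgroup.subset[OF subM]])
    then have "x \<in> M" using maximal_not_normal_normalizer[OF fin M(1) no[OF M(1)]] by simp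
    then show False using x self_mem_conjugates[OF subgroup.subset[OF subM]] by blast
  qed
  then obtain K where K: "maximal_subgroup K" "cyclic_extension N x \<subseteq> K"
    using maximal_subgroup_exists[OF fin ext(1)] by blast
  have NK: "N \<subseteq> K" using K(2) ext(2) by blast
  \<comment> \<open>A common element outside \<open>N\<close> would lie in coinciding conjugates of
    \<open>M\<close> and \<open>K\<close>. Then \<open>K\<close>, which contains \<open>x\<close>,
    would be a conjugate of \<open>M\<close>.\<close>
  have "?U M \<inter> ?U K = {}"
  proof (rule ccontr)
    assume "?U M \<inter> ?U K \<noteq> {}"
    then obtain u C D where u: "u \<in> C" "u \<in> D" "u \<notin> N" and CD: "C \<in> conjugates M" "D \<in> conjugates K" by blast
    have "C = D" using int[OF conjN(2)[OF CD(1) M] conjN(2)[OF CD(2) K(1) NK]]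
        conjN(1)[OF CD(1) M] conjN(1)[OF CD(2) K(1) NK] u by blast
    then obtain g h where g: "g \<in> carrier G" "C = g <# M #> inv g" and h: "h \<in> carrier G" "K = h <# C #> inv h"
      using CD conjugates_cong[OF subgroup.subset[OF maxD(1)[OF K(1)]] CD(2)] by (auto simp: conjugates_def)
    have "K = (h \<otimes> g) <# M #> inv (h \<otimes> g)"
    proof (rule Set.set_eqI)
      fix y
      have MG: "M \<subseteq> carrier G" and CG: "C \<subseteq> carrier G" and KG: "K \<subseteq> carrier G"
        using subgroup.subset[OF subM] subgroup.subset[OF maxD(1)[OF conjN(2)[OF CD(1) M]]]
          subgroup.subset[OF maxD(1)[OF K(1)]] by auto
      have hg: "(h \<otimes> g) <# M #> inv (h \<otimes> g) \<subseteq> carrier G"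
        using MG g h by (simp add: l_coset_subset_G r_coset_subset_G)
      show "y \<in> K \<longleftrightarrow> y \<in> (h \<otimes> g) <# M #> inv (h \<otimes> g)"
      proof (cases "y \<in> carrier G")
        case True
        have "y \<in> K \<longleftrightarrow> inv h \<otimes> y \<otimes> h \<in> C" using mem_conjugate_iff[OF CG h(1) True] h(2) by simp
        also have "\<dots> \<longleftrightarrow> inv g \<otimes> (inv h \<otimes> y \<otimes> h) \<otimes> g \<in> M"
          using mem_conjugate_iff[OF MG g(1), of "inv h \<otimes> y \<otimes> h"] g h(1) True by simp
        also have "inv g \<otimes> (inv h \<otimes> y \<otimes> h) \<otimes> g = inv (h \<otimes> g) \<otimes> y \<otimes> (h \<otimes> g)"
          using g h True by (simp add: m_assoc inv_mult_group)
        also have "\<dots> \<in> M \<longleftrightarrow> y \<in> (h \<otimes> g) <# M #> inv (h \<otimes> g)"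
          using mem_conjugate_iff[OF MG, of "h \<otimes> g" y] g h True by simp
        finally show ?thesis .
      qed (use hg KG in blast)
    qed
    then have "K \<in> conjugates M" using g h unfolding conjugates_def by blast
    then show False using x ext(3) K(2) by blast
  qed
  then have "card (?U M) + card (?U K) = card (?U M \<union> ?U K)"
    using finite_subset[OF UG] M K NK fin by (intro card_Un_disjoint[symmetric]) auto
  also have "\<dots> \<le> card (carrier G - N)"
    using UG[OF M] UG[OF K(1) NK] fin by (intro card_mono) auto
  finally have "card (?U M) + card (?U K) \<le> order G - card N" using cGN by simp
  moreover have "order G > 0" using fin order_gt_0_iff_finite by blast
  ultimately show False using half(1)[OF M] half(1)[OF K(1) NK] N0 by linarith
qed

end

subsection \<open>Minimal non-nilpotent groups\<close>

context group begin

lemma minimal_nonnilpotent_no_ES_partition: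
  assumes fin: "finite (carrier G)" and nonnil: "\<not> nilpotent_group G"
    and nil: "\<And>H. \<lbrakk>subgroup H G; H \<noteq> carrier G\<rbrakk> \<Longrightarrow> nilpotent_group (G\<lparr>carrier := H\<rparr>)"
  shows "\<not> ES_partition G S \<P>"
proof
  assume ES: "ES_partition G S \<P>"
  have "carrier G \<noteq> {\<one>}"
  proof
    assume "carrier G = {\<one>}"
    then have "upper_central G 0 = carrier G" by simp
    then show False using nonnil is_group unfolding nilpotent_group_def by blast
  qed
  then obtain N where N: "maximal_subgroup N" "N \<lhd> G"
    using proper_nilpotent_imp_normal_maximal[OF fin _ nil] by blast
  have subN: "subgroup N G" and Nne: "N \<noteq> carrier G"
    using N(1) by (auto simp: maximal_subgroup_def proper_subgroup_def)
  have NG: "N \<subseteq> carrier G" by (rule subgroup.subset[OF subN])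
  have nilN: "nilpotent_group (G\<lparr>carrier := N\<rparr>)" by (rule nil[OF subN Nne])
  interpret N: group "G\<lparr>carrier := N\<rparr>" by (rule subgroup_imp_group[OF subN])
  have finN: "finite (carrier (G\<lparr>carrier := N\<rparr>))" using finite_subset[OF NG fin] by simp
  obtain q where q: "Factorial_Ring.prime (q::nat)" "order G = q * card N" "\<And>x. x \<in> carrier G \<Longrightarrow> x [^] q \<in> N"
    using normal_maximal_subgroup_index[OF fin N] by metis
  have memN: "u \<in> N" if u: "u \<in> carrier G" "u [^] (r ^ k) = \<one>" "Factorial_Ring.prime (r::nat)" "r \<noteq> q" for u r k
  proof (rule subgroup_coprime_powers_mem[OF subN u(1) q(3)[OF u(1)]])
    show "u [^] (r ^ k) \<in> N" using u(2) subgroup.one_closed[OF subN] by simp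
    show "coprime q (r ^ k)" using u q(1) by (simp add: primes_coprime)
  qed
  have commN: "u \<otimes> v = v \<otimes> u"
    if "u \<in> N" "v \<in> N" "u [^] (a::nat) = \<one>" "v [^] (b::nat) = \<one>" "coprime a b" for u v a b
    using N.nilpotent_coprime_commute[OF nilN, of u v a b] that by (simp flip: nat_pow_consistent)
  \<comment> \<open>A non-commuting pair of coprime prime power orders cannot lie in the nilpotent
    subgroup \<open>N\<close>. As \<open>N\<close> contains the elements of prime power order for
    primes other than \<open>q\<close>, one of the two is a \<open>q\<close>-element; it is named
    \<open>x\<close>.\<close>
  obtain x y t k l where xy: "x \<in> carrier G" "y \<in> carrier G" "Factorial_Ring.prime (t::nat)" "t \<noteq> q"
    "x [^] (q ^ k) = \<one>" "y [^] (t ^ l) = \<one>" "x \<otimes> y \<noteq> y \<otimes> x"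
  proof -
    have "\<not> prime_commuting" using prime_commuting_imp_nilpotent[OF fin] nonnil by blast
    then obtain x y p t k l where *: "x \<in> carrier G" "y \<in> carrier G" "Factorial_Ring.prime (p::nat)"
      "Factorial_Ring.prime (t::nat)" "p \<noteq> t" "x [^] (p ^ k) = \<one>" "y [^] (t ^ l) = \<one>" "x \<otimes> y \<noteq> y \<otimes> x"
      unfolding prime_commuting_def by blast
    have "coprime (p ^ k) (t ^ l)" using * by (simp add: primes_coprime)
    then have "p = q \<or> t = q"
      using commN[of x y "p ^ k" "t ^ l"] memN[of x p k] memN[of y t l] * by blast
    then show thesis
    proof
      assume "p = q"
      then show thesis using that[of x y t k l] * by simp
    next
      assume "t = q"
      then show thesis using that[of y x p l k] * by metis
    qed
  qed
  have yN: "y \<in> N" by (rule memN[OF xy(2,6,3,4)])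
  obtain P where P: "subgroup P (G\<lparr>carrier := N\<rparr>)" "card P = t ^ multiplicity t (order (G\<lparr>carrier := N\<rparr>))"
    using N.sylow_subgroup_exists[OF finN xy(3)] .
  have normP: "P \<lhd> G\<lparr>carrier := N\<rparr>" by (rule N.nilpotent_sylow_normal[OF finN nilN xy(3) P])
  have subP: "subgroup P G" by (rule incl_subgroup[OF subN P(1)])
  \<comment> \<open>\<open>P\<close> collects all elements of \<open>t\<close>-power order in the
    whole group, not just those of \<open>N\<close>; conjugation preserves this set, so
    \<open>P\<close> is normal in the whole group.\<close>
  have memP: "u \<in> P" if "u \<in> carrier G" "u [^] (t ^ j) = \<one>" for u j
    using N.normal_sylow_mem[OF finN normP P(2) xy(3), of u j] memN[OF that xy(3,4)] that(2)
    by (simp flip: nat_pow_consistent)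
  have P_G: "P \<lhd> G"
  proof (rule normal_invI[OF subP])
    fix g u assume g: "g \<in> carrier G" and u: "u \<in> P"
    have uc: "u \<in> carrier G" using subgroup.mem_carrier[OF subP u] .
    have "u [^] card P = \<one>" by (rule subgroup_pow_card[OF subP u])
    then have "(g \<otimes> u \<otimes> inv g) [^] (t ^ multiplicity t (order (G\<lparr>carrier := N\<rparr>))) = \<one>"
      using P(2) g uc by (simp add: pow_conjugate)
    then show "g \<otimes> u \<otimes> inv g \<in> P" using g uc by (intro memP) auto
  qed
  have yP: "y \<in> P" by (rule memP[OF xy(2,6)])
  note ext = cyclic_extension[OF fin P_G xy(1)]
  \<comment> \<open>This subgroup contains both \<open>x\<close> and \<open>y\<close>, which do not
    commute although their orders are coprime, so it is not nilpotent and cannot be proper.\<close>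
  have extG: "cyclic_extension P x = carrier G"
  proof (rule ccontr)
    assume ne: "cyclic_extension P x \<noteq> carrier G"
    interpret E: group "G\<lparr>carrier := cyclic_extension P x\<rparr>" by (rule subgroup_imp_group[OF ext(1)])
    have "y \<in> cyclic_extension P x" using yP ext(2) by blast
    moreover have "coprime (q ^ k) (t ^ l)" using q(1) xy(3,4) by (simp add: primes_coprime)
    ultimately have "x \<otimes> y = y \<otimes> x"
      using E.nilpotent_coprime_commute[OF nil[OF ext(1) ne], of x y "q ^ k" "t ^ l"] ext(3) xy(5,6)
      by (simp flip: nat_pow_consistent)
    then show False using xy(7) by simp
  qed
  define r where "r = group.ord (G Mod P) (P #> x)"
  have ordG: "order G = r * card P" using ext(5) extG by (simp add: r_def order_def)
  have r_dvd: "r dvd ord x"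
    unfolding r_def using subgroup.one_closed[OF subP] xy(1) by (intro ord_Mod_dvd[OF P_G xy(1)]) simp
  have "ord x dvd q ^ k" using xy(1,5) pow_eq_id by simp
  then obtain e where e: "ord x = q ^ e" using divides_primepow_nat[OF q(1)] by blast
  have g0: "order G \<noteq> 0" using fin order_gt_0_iff_finite by auto
  have "coprime (q ^ e) (card P)" using P(2) q(1) xy(3,4) by (simp add: primes_coprime)
  moreover have "q ^ e dvd r * card P" using ord_dvd_group_order[OF xy(1)] ordG e by simp
  ultimately have "q ^ e dvd r" by (simp only: coprime_dvd_mult_left_iff)
  \<comment> \<open>No power of \<open>x\<close> is lost modulo \<open>P\<close>, so the subgroup
    generated by \<open>x\<close> has the full \<open>q\<close>-part of the group order.\<close>
  then have r: "r = q ^ e" using r_dvd e dvd_antisym by simp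
  have "\<not> q dvd card P"
  proof
    assume "q dvd card P"
    then have "q dvd t" using P(2) q(1) prime_dvd_power by metis
    then show False using primes_dvd_imp_eq[OF q(1) xy(3)] xy(4) by simp
  qed
  then have mult: "multiplicity q (order G) = e"
    using ordG r q(1) by (intro multiplicity_eqI) (auto simp: mult.commute)
  let ?R = "generate G {x}"
  have subR: "subgroup ?R G" using xy(1) by (intro generate_is_subgroup) simp
  have cardR: "card ?R = q ^ multiplicity q (order G)"
    using generate_pow_card[OF xy(1)] e mult by simp
  have R_comm: "?R \<subseteq> centralizer x"
    by (rule generate_subgroup_incl[OF _ centralizer_subgroup[OF xy(1)]]) (use xy(1) in simp)
  have part: "strict_partition G S \<P>" and eq: "\<And>H K. \<lbrakk>H \<in> \<P>; K \<in> \<P>\<rbrakk> \<Longrightarrow> card H = card K"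
    using ES unfolding ES_partition_def by blast+
  then have sub: "\<And>H. H \<in> \<P> \<Longrightarrow> subgroup H G" and ne: "\<And>H. H \<in> \<P> \<Longrightarrow> H \<noteq> carrier G"
    and cover: "carrier G = \<Union> \<P>"
    unfolding strict_partition_def proper_subgroup_def by blast+
  have "w \<in> \<Union> (conjugates (centralizer x))" if w: "w \<in> carrier G" for w
  proof -
    obtain H where H: "H \<in> \<P>" "w \<in> H" using w cover by blast
    obtain H1 where H1: "H1 \<in> \<P>" "x \<in> H1" using xy(1) cover by blast
    have subH: "subgroup H G" by (rule sub[OF H(1)])
    have HG: "H \<subseteq> carrier G" by (rule subgroup.subset[OF subH])
    interpret H: group "G\<lparr>carrier := H\<rparr>" by (rule subgroup_imp_group[OF subH])
    have finH: "finite (carrier (G\<lparr>carrier := H\<rparr>))" using finite_subset[OF HG fin] by simp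
    have nilH: "nilpotent_group (G\<lparr>carrier := H\<rparr>)" by (rule nil[OF subH ne[OF H(1)]])
    have "?R \<subseteq> H1" using H1 by (intro generate_subgroup_incl sub) auto
    \<comment> \<open>The component containing \<open>x\<close> contains a whole Sylow
      \<open>q\<close>-subgroup; equality of the orders carries the divisibility over to
      \<open>H\<close>.\<close>
    then have dv: "q ^ e dvd card H"
      using card_subgroup_dvd_subgroup[OF subR sub[OF H1(1)]] cardR mult eq[OF H1(1) H(1)] by simp
    have "multiplicity q (card H) \<le> e"
      using card_subgroup_dvd[OF subH] g0 mult dvd_imp_multiplicity_le by metis
    have "order (G\<lparr>carrier := H\<rparr>) = q ^ e * (card H div q ^ e)" using dv by (simp add: order_def)
    then obtain Q where Q: "subgroup Q (G\<lparr>carrier := H\<rparr>)" "card Q = q ^ e"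
      using sylow_thm[OF q(1) H.is_group _ finH] by blast
    have subQ: "subgroup Q G" by (rule incl_subgroup[OF subH Q(1)])
    have QH: "Q \<subseteq> H" using subgroup.subset[OF Q(1)] by simp
    obtain g where g: "g \<in> carrier G" "Q \<subseteq> g <# ?R #> inv g"
      using sylow_conjugate[OF fin q(1) subQ Q(2) subR cardR] .
    have RG: "?R \<subseteq> carrier G" by (rule subgroup.subset[OF subR])
    have conjR: "subgroup (g <# ?R #> inv g) G" "card (g <# ?R #> inv g) = card ?R"
      by (rule conjugate_subgroup[OF subR g(1)])+
    have Q_eq: "Q = g <# ?R #> inv g"
      using card_subset_eq[OF finite_subset[OF subgroup.subset[OF conjR(1)] fin] g(2)] conjR(2) cardR Q(2) mult by simp
    let ?x = "g \<otimes> x \<otimes> inv g"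
    have xc: "?x \<in> carrier G" using g(1) xy(1) by simp
    have xR: "x \<in> ?R" by (simp add: generate.incl)
    have xQ: "?x \<in> Q" unfolding Q_eq using xR by (auto simp: l_coset_def r_coset_def)
    let ?C = "H \<inter> centralizer ?x"
    have subC: "subgroup ?C G" by (rule subgroups_Inter_pair[OF subH centralizer_subgroup[OF xc]])
    \<comment> \<open>A Sylow \<open>q\<close>-subgroup of \<open>H\<close> is a conjugate of the
      cyclic group of \<open>x\<close>, hence centralizes the conjugate \<open>?x\<close>; the other
      Sylow subgroups of the nilpotent \<open>H\<close> commute with \<open>?x\<close> by
      coprimality.\<close>
    have "?C = carrier (G\<lparr>carrier := H\<rparr>)"
    proof (rule H.subgroup_eq_carrierI[OF finH])
      show "subgroup ?C (G\<lparr>carrier := H\<rparr>)" by (rule subgroup_incl[OF subC subH]) blast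
      fix s :: nat assume s: "Factorial_Ring.prime s"
      show "s ^ multiplicity s (order (G\<lparr>carrier := H\<rparr>)) dvd card ?C"
      proof (cases "s = q")
        case True
        have "Q \<subseteq> ?C"
        proof
          fix u assume u: "u \<in> Q"
          then obtain v where v: "v \<in> ?R" "u = g \<otimes> v \<otimes> inv g"
            unfolding Q_eq by (auto simp: l_coset_def r_coset_def)
          have vc: "v \<in> carrier G" "v \<otimes> x = x \<otimes> v" using v(1) R_comm by auto
          have "u \<otimes> ?x = g \<otimes> (v \<otimes> x) \<otimes> inv g" using v(2) vc(1) g(1) xy(1) by (simp add: m_assoc)
          also have "\<dots> = g \<otimes> (x \<otimes> v) \<otimes> inv g" using vc(2) by simp
          also have "\<dots> = ?x \<otimes> u" using v(2) vc(1) g(1) xy(1) by (simp add: m_assoc)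
          finally show "u \<in> ?C" using u QH HG by auto
        qed
        then have "q ^ e dvd card ?C" using card_subgroup_dvd_subgroup[OF subQ subC] Q(2) by simp
        moreover have "q ^ multiplicity q (card H) dvd q ^ e"
          using \<open>multiplicity q (card H) \<le> e\<close> by (rule le_imp_power_dvd)
        ultimately show ?thesis using True dvd_trans by (simp add: order_def)
      next
        case False
        obtain T where T: "subgroup T (G\<lparr>carrier := H\<rparr>)" "card T = s ^ multiplicity s (order (G\<lparr>carrier := H\<rparr>))"
          using H.sylow_subgroup_exists[OF finH s] .
        have subT: "subgroup T G" by (rule incl_subgroup[OF subH T(1)])
        have "T \<subseteq> ?C"
        proof
          fix u assume u: "u \<in> T"
          have uH: "u \<in> H" using u subgroup.subset[OF T(1)] by auto
          have "u [^] card T = \<one>" "?x [^] card Q = \<one>"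
            using subgroup_pow_card[OF subT u] subgroup_pow_card[OF subQ xQ] by auto
          moreover have "coprime (card T) (card Q)" using T(2) Q(2) s q(1) False by (simp add: primes_coprime)
          ultimately have "u \<otimes> ?x = ?x \<otimes> u"
            using H.nilpotent_coprime_commute[OF nilH, of u ?x "card T" "card Q"] uH xQ QH
            by (auto simp flip: nat_pow_consistent)
          then show "u \<in> ?C" using uH HG by auto
        qed
        then show ?thesis using card_subgroup_dvd_subgroup[OF subT subC] T(2) by simp
      qed
    qed
    then have "w \<otimes> ?x = ?x \<otimes> w" using H(2) by auto
    then have "inv g \<otimes> (w \<otimes> ?x) \<otimes> g = inv g \<otimes> (?x \<otimes> w) \<otimes> g" by simp
    then have "(inv g \<otimes> w \<otimes> g) \<otimes> x = x \<otimes> (inv g \<otimes> w \<otimes> g)"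
      using w g(1) xy(1) by (simp add: m_assoc)
    then have "inv g \<otimes> w \<otimes> g \<in> centralizer x" using w g(1) by simp
    then have "w \<in> g <# centralizer x #> inv g"
      using mem_conjugate_iff[of "centralizer x" g w] g(1) w by auto
    then show ?thesis using g(1) unfolding conjugates_def by blast
  qed
  then have "centralizer x = carrier G"
    using conjugates_not_cover[OF fin centralizer_subgroup[OF xy(1)]] by blast
  then have "y \<in> centralizer x" using xy(2) by simp
  then show False using xy(7) by simp
qed

lemma cyclic_imp_nilpotent:
  assumes fin: "finite (carrier G)" and "cyclic_group G"
  shows "nilpotent_group G"
proof -
  interpret comm_group G by (rule cyclic_imp_abelian_group) fact
  have prime_commuting unfolding prime_commuting_def using m_comm by blast
  then show ?thesis by (rule prime_commuting_imp_nilpotent[OF fin])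
qed

text \<open>Induction on the order makes a non-nilpotent \<open>H\<close> minimal. It is not cyclic,
  because cyclic groups are nilpotent, so it has an ES-partition, which
  \<open>minimal_nonnilpotent_no_ES_partition\<close> forbids.\<close>

lemma all_ES_partition_imp_nilpotent:
  assumes fin: "finite (carrier G)"
    and ES: "\<And>H. \<lbrakk>subgroup H G; \<not> cyclic_group (G\<lparr>carrier := H\<rparr>)\<rbrakk>
      \<Longrightarrow> \<exists>S P. ES_partition (G\<lparr>carrier := H\<rparr>) S P"
    and H: "subgroup H G"
  shows "nilpotent_group (G\<lparr>carrier := H\<rparr>)"
  using H
proof (induction "card H" arbitrary: H rule: less_induct)
  case less
  interpret H: group "G\<lparr>carrier := H\<rparr>" by (rule subgroup_imp_group[OF less.prems])
  have finH: "finite H" by (rule finite_subset[OF subgroup.subset[OF less.prems] fin])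
  show ?case
  proof (rule ccontr)
    assume non: "\<not> nilpotent_group (G\<lparr>carrier := H\<rparr>)"
    then obtain S P where "ES_partition (G\<lparr>carrier := H\<rparr>) S P"
      using ES[OF less.prems] H.cyclic_imp_nilpotent finH by auto
    moreover have "nilpotent_group (G\<lparr>carrier := H, carrier := K\<rparr>)"
      if K: "subgroup K (G\<lparr>carrier := H\<rparr>)" "K \<noteq> carrier (G\<lparr>carrier := H\<rparr>)" for K
    proof -
      have "K \<subset> H" using K subgroup.subset[OF K(1)] by auto
      then have "card K < card H" by (rule psubset_card_mono[OF finH])
      then show ?thesis using less.hyps[OF _ incl_subgroup[OF less.prems K(1)]] by simp
    qed
    ultimately show False
      using H.minimal_nonnilpotent_no_ES_partition[OF _ non] finH by simp
  qed
qed

end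

theorem theorem1p2:
  fixes G :: "('a, 'b) monoid_scheme"
  assumes "group G" and "finite (carrier G)" and "\<not> cyclic_group G"
  shows "(nilpotent_group G \<longleftrightarrow>
            (\<exists>S. subgroup S G \<and> (\<exists>P. ES_partition G S P) \<and> S \<lhd> G \<and>
                 (\<exists>i. S \<subseteq> upper_central G i))) \<and>
         (nilpotent_group G \<longleftrightarrow>
            (\<forall>H. subgroup H G \<and> \<not> cyclic_group (G\<lparr>carrier := H\<rparr>) \<longrightarrow>
                 (\<exists>S. subgroup S (G\<lparr>carrier := H\<rparr>) \<and>
                      (\<exists>P. ES_partition (G\<lparr>carrier := H\<rparr>) S P))))"
proof (intro conjI iffI)
  interpret group G by fact
  show "\<exists>S. subgroup S G \<and> (\<exists>P. ES_partition G S P) \<and> S \<lhd> G \<and> (\<exists>i. S \<subseteq> upper_central G i)"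
    if nil: "nilpotent_group G"
  proof -
    obtain S P where SP: "ES_partition G S P" "S \<lhd> G"
      using nilpotent_ES_partition[OF assms(2) nil assms(3)] .
    \<comment> \<open>In a nilpotent group some term of the series is everything, so every subgroup
      is hypercentral.\<close>
    obtain c where "upper_central G c = carrier G" using nil by (auto simp: nilpotent_group_def)
    moreover have "subgroup S G" using SP(2) by (rule normal_imp_subgroup)
    ultimately show ?thesis using SP subgroup.subset by metis
  qed
  show "nilpotent_group G"
    if "\<exists>S. subgroup S G \<and> (\<exists>P. ES_partition G S P) \<and> S \<lhd> G \<and> (\<exists>i. S \<subseteq> upper_central G i)"
    using that ES_partition_imp_nilpotent[OF assms(2)] by blast
  show "\<forall>H. subgroup H G \<and> \<not> cyclic_group (G\<lparr>carrier := H\<rparr>) \<longrightarrow>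
      (\<exists>S. subgroup S (G\<lparr>carrier := H\<rparr>) \<and> (\<exists>P. ES_partition (G\<lparr>carrier := H\<rparr>) S P))"
    if nil: "nilpotent_group G"
  proof (intro allI impI, elim conjE)
    fix H assume H: "subgroup H G" "\<not> cyclic_group (G\<lparr>carrier := H\<rparr>)"
    interpret H: group "G\<lparr>carrier := H\<rparr>" by (rule subgroup_imp_group[OF H(1)])
    have "finite (carrier (G\<lparr>carrier := H\<rparr>))"
      using finite_subset[OF subgroup.subset[OF H(1)] assms(2)] by simp
    then obtain S P where "ES_partition (G\<lparr>carrier := H\<rparr>) S P" "S \<lhd> G\<lparr>carrier := H\<rparr>"
      using H.nilpotent_ES_partition[OF _ nilpotent_subgroup[OF nil H(1)] H(2)] by metis
    then show "\<exists>S. subgroup S (G\<lparr>carrier := H\<rparr>) \<and> (\<exists>P. ES_partition (G\<lparr>carrier := H\<rparr>) S P)"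
      using normal_imp_subgroup by blast
  qed
  show "nilpotent_group G"
    if "\<forall>H. subgroup H G \<and> \<not> cyclic_group (G\<lparr>carrier := H\<rparr>) \<longrightarrow>
      (\<exists>S. subgroup S (G\<lparr>carrier := H\<rparr>) \<and> (\<exists>P. ES_partition (G\<lparr>carrier := H\<rparr>) S P))"
  proof -
    have "nilpotent_group (G\<lparr>carrier := carrier G\<rparr>)"
      by (rule all_ES_partition_imp_nilpotent[OF assms(2) _ subgroup_self]) (use that in blast)
    then show ?thesis by simp
  qed
qed

end
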